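(* Let $m\ge n$ be positive integers, and suppose $E_{n,m}=\{T_1,\dots,T_s\}$ and $F_{n,m}=\{T'_1,\dots,T'_r\}$ with $r\in\{2,3\}$. The maximal ideals of $\mathcal{T}_{n,m}$ are the ideals of the form $$M_{\underline t}:=\langle T_1-t_1,\dots,T_s-t_s,\;T'_1-t'_1,\dots,T'_r-t'_r\rangle_{\mathcal{T}_{n,m}}$$ where $\underline t=(t_1,\dots,t_s,t'_1,\dots,t'_r)\in\mathcal{V}(\mathcal{P}_{n,m})\times\mathbb{K}^{|F_{n,m}|}$.
   Context: Let $\mathbb{K}$ be an algebraically closed field of characteristic zero. A semistandard Young tableau of partition shape $\lambda$ is a filling of the Ferrers diagram of $\lambda$ (English notation) with positive integers, strictly increasing down columns and weakly increasing from left to right along rows. For positive integers $m\ge n$, $\mathrm{SSYT}_m^n$ denotes the set of all semistandard Young tableaux of all partition shapes with at most $n$ rows and with entries in $\{1,\dots,m\}$ (including the empty tableau $\emptyset$). For $T$ of shape $\lambda$ and $T'$ of shape $\mu$, $T\star T'$ is the semistandard Young tableau of shape $\lambda+\mu$ obtained by horizontally concatenating the rows of $T$ and $T'$ and sorting the entries in each row in weakly increasing order. $(\mathrm{SSYT}_m^n,\star,\emptyset)$ is a commutative monoid, and the tableaux algebra $\mathcal{T}_{n,m}$ is its monoid algebra over $\mathbb{K}$. Let $G_{n,m}$ be the set of tableaux in $\mathrm{SSYT}_m^n$ with exactly one column (of height $1,\dots,n$). Write $[a_1,\dots,a_k]$ for the column with entries $a_1<\dots<a_k$ from top to bottom. Set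 $F_{n,n}=\{[n],\,[1,2,\dots,n-1],\,[1,2,\dots,n]\}$, and $F_{n,m}=\{[m],\,[1,2,\dots,n]\}$ if $m\ne n$. Set $E_{n,m}=G_{n,m}\setminus F_{n,m}$. For a finite set $Y$, $\mathbb{K}[Y]$ is the polynomial ring in commuting variables indexed by $Y$. A product relation is a binomial $T_1T_2-T_3T_4$ with $T_1,T_2,T_3,T_4\in G_{n,m}$ distinct and $T_1\star T_2=T_3\star T_4$; all product relations involve only variables in $E_{n,m}$, and $\mathcal{P}_{n,m}$ is the ideal they generate, regarded in $\mathbb{K}[E_{n,m}]$. $\mathcal{V}(\mathcal{P}_{n,m})\subseteq\mathbb{K}^{|E_{n,m}|}$ is its zero locus. $\langle\,\cdot\,\rangle_{R}$ denotes the ideal generated in the ring $R$. *)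

theory Defs
  imports
    "HOL-Library.FuncSet"
    "HOL-Library.Multiset"
    "HOL-Library.Poly_Mapping"
    "HOL-Computational_Algebra.Polynomial"
    "HOL-Algebra.Ideal"
begin

section \<open>Semistandard Young tableaux\<close>

text \<open>
  A tableau is the list of its rows from top to bottom; its shape is the list of row lengths.
  Rows are nonempty, so that every shape is a partition without trailing zeros and the empty
  tableau is the empty list.  \<open>row_above r s\<close> says that row \<open>s\<close> may stand directly below row
  \<open>r\<close>: it is not longer, and columns increase strictly.
\<close>

definition row_above :: "nat list \<Rightarrow> nat list \<Rightarrow> bool" where
  "row_above r s \<longleftrightarrow> length s \<le> length r \<and> (\<forall>j < length s. r ! j < s ! j)"

definition is_ssyt :: "nat list list \<Rightarrow> bool" where
  "is_ssyt T \<longleftrightarrow> (\<forall>r \<in> set T. r \<noteq> [] \<and> sorted r \<and> (\<forall>a \<in> set r. 1 \<le> a)) \<and> successively row_above T"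

fun star_rows :: "nat list list \<Rightarrow> nat list list \<Rightarrow> nat list list" where
  "star_rows [] U = U"
| "star_rows (r # T) [] = r # T"
| "star_rows (r # T) (s # U) = sort (r @ s) # star_rows T U"

lemma row_above_iff_filter:
  assumes "sorted r" "sorted s"
  shows "row_above r s \<longleftrightarrow> (\<forall>v. length (filter (\<lambda>a. a \<le> v) s) \<le> length (filter (\<lambda>a. a < v) r))"
proof
  assume *: "row_above r s"
  show "\<forall>v. length (filter (\<lambda>a. a \<le> v) s) \<le> length (filter (\<lambda>a. a < v) r)"
  proof
    fix v
    show "length (filter (\<lambda>a. a \<le> v) s) \<le> length (filter (\<lambda>a. a < v) r)"
      unfolding length_filter_conv_card
      by (rule card_mono) (use * in \<open>force simp: row_above_def\<close>)+
  qed
next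
  assume *: "\<forall>v. length (filter (\<lambda>a. a \<le> v) s) \<le> length (filter (\<lambda>a. a < v) r)"
  have key: "j < length r \<and> r ! j < s ! j" if j: "j < length s" for j
  proof (rule ccontr)
    assume neg: "\<not> (j < length r \<and> r ! j < s ! j)"
    have "card {..j} \<le> card {i. i < length s \<and> s ! i \<le> s ! j}"
      by (rule card_mono) (use j assms(2) in \<open>auto simp: sorted_iff_nth_mono\<close>)
    also have "\<dots> \<le> card {i. i < length r \<and> r ! i < s ! j}"
      using * unfolding length_filter_conv_card by blast
    also have "{i. i < length r \<and> r ! i < s ! j} \<subseteq> {..<j}"
    proof
      fix i assume i: "i \<in> {i. i < length r \<and> r ! i < s ! j}"
      show "i \<in> {..<j}"
      proof (rule ccontr)
        assume "i \<notin> {..<j}"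
        then have "r ! j \<le> r ! i" "j < length r"
          using i assms(1) by (auto simp: sorted_iff_nth_mono)
        then show False using i neg by auto
      qed
    qed
    then have "card {i. i < length r \<and> r ! i < s ! j} \<le> card {..<j}"
      by (intro card_mono) auto
    finally show False by simp
  qed
  have "length s \<le> length r"
    using key[of "length s - 1"] by (cases "length s") auto
  with key show "row_above r s" by (auto simp: row_above_def)
qed

lemma length_filter_sort [simp]: "length (filter P (sort xs)) = length (filter P xs)"
  by (metis mset_filter mset_sort size_mset)

lemma row_above_sort_append:
  assumes "sorted r" "sorted s" "sorted r'" "sorted s'" "row_above r s" "row_above r' s'"
  shows "row_above (sort (r @ r')) (sort (s @ s'))"
  using assms by (auto simp: row_above_iff_filter intro: add_mono)

lemma row_above_Nil [simp]: "row_above r []"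
  by (simp add: row_above_def)

lemma is_ssyt_Nil: "is_ssyt []"
  by (simp add: is_ssyt_def)

lemma is_ssyt_Cons:
  "is_ssyt (r # T) \<longleftrightarrow> r \<noteq> [] \<and> sorted r \<and> (\<forall>a \<in> set r. 1 \<le> a) \<and>
     row_above r (case T of [] \<Rightarrow> [] | s # _ \<Rightarrow> s) \<and> is_ssyt T"
  by (cases T) (simp_all add: is_ssyt_def conj_ac)

lemma is_ssyt_star_rows: "is_ssyt T \<Longrightarrow> is_ssyt U \<Longrightarrow> is_ssyt (star_rows T U)"
proof (induction T U rule: star_rows.induct)
  case (3 r T s U)
  let ?h = "\<lambda>T. case T of [] \<Rightarrow> [] | s # _ \<Rightarrow> (s :: nat list)"
  have hd: "?h (star_rows T U) = sort (?h T @ ?h U)"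
    using 3(2,3) by (cases T; cases U) (auto simp: is_ssyt_Cons sorted_sort_id)
  have "sorted (?h T)" "sorted (?h U)"
    using 3(2,3) by (auto simp: is_ssyt_Cons split: list.splits)
  then have "row_above (sort (r @ s)) (?h (star_rows T U))"
    unfolding hd using 3(2,3) by (intro row_above_sort_append) (auto simp: is_ssyt_Cons)
  moreover have "sort (r @ s) \<noteq> []"
    using 3(2) by (metis append_is_Nil_conv is_ssyt_Cons set_empty set_sort)
  ultimately show ?case
    using 3 by (auto simp: is_ssyt_Cons)
qed auto

lemma star_rows_Nil_right: "star_rows T [] = T"
  by (cases T) auto

lemma star_rows_commute: "star_rows T U = star_rows U T"
proof (induction T U rule: star_rows.induct)
  case (3 r T s U)
  have "sort (r @ s) = sort (s @ r)"
    by (rule properties_for_sort) auto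
  with 3 show ?case by simp
qed (auto simp: star_rows_Nil_right)

lemma star_rows_assoc: "star_rows (star_rows T U) V = star_rows T (star_rows U V)"
proof (induction T U arbitrary: V rule: star_rows.induct)
  case (3 r T s U)
  show ?case
  proof (cases V)
    case (Cons t V')
    have "sort (sort (r @ s) @ t) = sort (r @ sort (s @ t))"
      by (rule properties_for_sort) (auto simp: ac_simps)
    with 3 Cons show ?thesis by simp
  qed simp
qed (auto simp: star_rows_Nil_right)

typedef ssyt = "{T. is_ssyt T}"
  morphisms rows Abs_ssyt
  using is_ssyt_Nil by blast

setup_lifting type_definition_ssyt

text \<open>
  Tableaux form a commutative monoid, written additively so that the library's
  \<open>\<Rightarrow>\<^sub>0\<close> (finitely supported functions with convolution product) yields the monoid algebra:
  \<open>T + T'\<close> is the product of \<open>T\<close> and \<open>T'\<close> under the star operation, and \<open>0\<close> is the empty tableau.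
\<close>

instantiation ssyt :: comm_monoid_add
begin

lift_definition zero_ssyt :: ssyt is "[]"
  by (rule is_ssyt_Nil)

lift_definition plus_ssyt :: "ssyt \<Rightarrow> ssyt \<Rightarrow> ssyt" is star_rows
  by (rule is_ssyt_star_rows)

instance
  by standard (transfer, auto simp: star_rows_assoc intro: star_rows_commute)+

end

definition SSYT :: "nat \<Rightarrow> nat \<Rightarrow> ssyt set" where
  "SSYT n m = {T. length (rows T) \<le> n \<and> (\<forall>r \<in> set (rows T). set r \<subseteq> {1..m})}"

definition G_cols :: "nat \<Rightarrow> nat \<Rightarrow> ssyt set" where
  "G_cols n m = {T \<in> SSYT n m. rows T \<noteq> [] \<and> length (hd (rows T)) = 1}"

definition first_column :: "ssyt \<Rightarrow> nat list" where
  "first_column T = map hd (rows T)"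

text \<open>
  Note that \<open>[a..<b]\<close> excludes \<open>b\<close>.  As \<open>F_cols n m\<close> is a subset of \<open>G_cols n m\<close>, the expression
  \<open>[1..<n]\<close>, which for \<open>n = 1\<close> would denote an empty column, contributes no element when \<open>n = 1\<close>.
\<close>

definition F_cols :: "nat \<Rightarrow> nat \<Rightarrow> ssyt set" where
  "F_cols n m = {T \<in> G_cols n m. first_column T \<in>
     (if m = n then {[n], [1..<n], [1..<Suc n]} else {[m], [1..<Suc n]})}"

definition E_cols :: "nat \<Rightarrow> nat \<Rightarrow> ssyt set" where
  "E_cols n m = G_cols n m - F_cols n m"

lemma rows_one_column:
  "is_ssyt (r # T) \<Longrightarrow> length r = 1 \<Longrightarrow> r # T = map (\<lambda>a. [a]) (map hd (r # T))"
proof (induction T arbitrary: r)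
  case (Cons s T)
  then have "length s = 1"
    by (cases s) (auto simp: is_ssyt_Cons row_above_def)
  with Cons have "s # T = map (\<lambda>a. [a]) (map hd (s # T))"
    by (auto simp: is_ssyt_Cons)
  with Cons.prems(2) show ?case by (cases r) auto
qed (auto simp: length_Suc_conv)

lemma rows_G_cols: "T \<in> G_cols n m \<Longrightarrow> rows T = map (\<lambda>a. [a]) (first_column T)"
  using rows[of T] rows_one_column[of "hd (rows T)" "tl (rows T)"]
  by (auto simp: G_cols_def first_column_def)

lemma is_ssyt_column:
  "is_ssyt (map (\<lambda>a. [a]) xs) \<longleftrightarrow> sorted_wrt (<) xs \<and> (\<forall>a \<in> set xs. 1 \<le> a)"
proof -
  have "successively row_above (map (\<lambda>a. [a]) xs) \<longleftrightarrow> successively (<) xs"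
    by (simp add: successively_map row_above_def)
  then show ?thesis
    by (auto simp: is_ssyt_def successively_iff_sorted_wrt_strong)
qed

lemma inj_on_first_column: "inj_on first_column (G_cols n m)"
  by (rule inj_onI) (metis rows_G_cols rows_inject)

lemma first_column_G_cols:
  "first_column ` G_cols n m =
     {xs. xs \<noteq> [] \<and> length xs \<le> n \<and> sorted_wrt (<) xs \<and> set xs \<subseteq> {1..m}}" (is "_ = ?R")
proof (intro equalityI subsetI)
  fix xs assume "xs \<in> first_column ` G_cols n m"
  then obtain T where T: "T \<in> G_cols n m" "xs = first_column T" by auto
  then have eq: "rows T = map (\<lambda>a. [a]) xs" using rows_G_cols by simp
  then have "is_ssyt (map (\<lambda>a. [a]) xs)" using rows[of T] by simp
  with T eq show "xs \<in> ?R"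
    by (auto simp: G_cols_def SSYT_def is_ssyt_column)
next
  fix xs assume xs: "xs \<in> ?R"
  define T where "T = Abs_ssyt (map (\<lambda>a. [a]) xs)"
  have "is_ssyt (map (\<lambda>a. [a]) xs)" unfolding is_ssyt_column using xs by auto
  then have eq: "rows T = map (\<lambda>a. [a]) xs" by (simp add: T_def Abs_ssyt_inverse)
  with xs have "T \<in> G_cols n m" by (auto simp: G_cols_def SSYT_def hd_map)
  moreover have "first_column T = xs" by (simp add: first_column_def eq comp_def)
  ultimately show "xs \<in> first_column ` G_cols n m" by force
qed

lemma card_F_cols:
  assumes "1 \<le> n" "n \<le> m"
  shows "card (F_cols n m) = (if m = 1 then 1 else if m = n then 3 else 2)"
proof -
  let ?L = "if m = n then {[n], [1..<n], [1..<Suc n]} else {[m], [1..<Suc n]}"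
  have "first_column ` F_cols n m = first_column ` G_cols n m \<inter> ?L"
    by (auto simp: F_cols_def)
  also have "\<dots> = ?L - {[]}"
    using assms unfolding first_column_G_cols by (auto simp: sorted_wrt_append simp del: upt_Suc)
  finally have "card (F_cols n m) = card (?L - {[]})"
    using card_image[OF inj_on_subset[OF inj_on_first_column, of "F_cols n m" n m]]
    by (force simp: F_cols_def)
  moreover have "card (?L - {[]}) = (if m = 1 then 1 else if m = n then 3 else 2)"
  proof -
    consider "n = 1" "m = 1" | "n \<noteq> 1" "m = n" | "m \<noteq> 1" "m \<noteq> n"
      using assms by linarith
    then show ?thesis
    proof cases
      case 2
      have "n \<notin> set [1..<n]" by simp
      then have "[n] \<noteq> [1..<n]" by (metis list.set_intros(1))
      moreover have "[1..<n] \<noteq> [1..<Suc n]" "[n] \<noteq> [1..<Suc n]" "[1..<n] \<noteq> []"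
        using 2 assms by (auto dest: arg_cong[where f = length] simp del: upt_Suc)
      ultimately show ?thesis
        using 2 by (simp add: insert_Diff_if del: upt_Suc)
    next
      case 3
      have "m \<notin> set [1..<Suc n]" using 3 assms by auto
      then have "[m] \<noteq> [1..<Suc n]" by (metis list.set_intros(1))
      then show ?thesis
        using 3 assms by (simp add: insert_Diff_if del: upt_Suc)
    qed (simp add: insert_Diff_if)
  qed
  ultimately show ?thesis by simp
qed


section \<open>Monoid algebras and polynomial rings\<close>

text \<open>The monoid algebra of a submonoid \<open>A\<close> of the ambient additive monoid.\<close>

definition monoid_algebra :: "'a::comm_monoid_add set \<Rightarrow> ('a \<Rightarrow>\<^sub>0 'k::comm_ring_1) ring" where
  "monoid_algebra A = \<lparr>carrier = {f. Poly_Mapping.keys f \<subseteq> A}, mult = (*), one = 1, zero = 0, add = (+)\<rparr>"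

lemma cring_monoid_algebra:
  assumes "0 \<in> A" and "\<And>a b. a \<in> A \<Longrightarrow> b \<in> A \<Longrightarrow> a + b \<in> A"
  shows "cring (monoid_algebra A :: ('a::comm_monoid_add \<Rightarrow>\<^sub>0 'k::comm_ring_1) ring)"
proof -
  let ?C = "{f :: 'a \<Rightarrow>\<^sub>0 'k. Poly_Mapping.keys f \<subseteq> A}"
  have add: "f + g \<in> ?C" and mult: "f * g \<in> ?C" if "f \<in> ?C" "g \<in> ?C" for f g
  proof -
    show "f + g \<in> ?C"
      using that keys_add[of f g] by blast
    show "f * g \<in> ?C"
      using that keys_mult[of f g] assms(2) by auto blast
  qed
  have neg: "- f \<in> ?C" if "f \<in> ?C" for f
    using that by (auto simp: in_keys_iff subset_iff)
  have one: "1 \<in> ?C"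
    using assms(1) by (auto simp: in_keys_iff lookup_one when_def split: if_splits)
  show ?thesis
    unfolding monoid_algebra_def
  proof (intro cringI abelian_groupI comm_monoidI, goal_cases)
    case (6 f)
    then show ?case using neg[of f] by (intro bexI[of _ "- f"]) auto
  qed (use add mult one in \<open>auto simp: algebra_simps\<close>)
qed

definition tableaux_algebra :: "nat \<Rightarrow> nat \<Rightarrow> (ssyt \<Rightarrow>\<^sub>0 'k::field) ring" where
  "tableaux_algebra n m = monoid_algebra (SSYT n m)"

text \<open>
  The polynomial ring in the variables \<open>Y\<close> is the monoid algebra of the monomials in \<open>Y\<close>,
  a monomial being the finitely supported map of its exponents.
\<close>

definition poly_ring :: "'v set \<Rightarrow> (('v \<Rightarrow>\<^sub>0 nat) \<Rightarrow>\<^sub>0 'k::field) ring" where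
  "poly_ring Y = monoid_algebra {\<alpha>. Poly_Mapping.keys \<alpha> \<subseteq> Y}"

definition pvar :: "'v \<Rightarrow> ('v \<Rightarrow>\<^sub>0 nat) \<Rightarrow>\<^sub>0 'k::field" where
  "pvar v = Poly_Mapping.single (Poly_Mapping.single v 1) 1"

definition poly_value :: "('v \<Rightarrow> 'k) \<Rightarrow> (('v \<Rightarrow>\<^sub>0 nat) \<Rightarrow>\<^sub>0 'k::field) \<Rightarrow> 'k" where
  "poly_value x p = (\<Sum>\<alpha> \<in> Poly_Mapping.keys p.
     Poly_Mapping.lookup p \<alpha> * (\<Prod>v \<in> Poly_Mapping.keys \<alpha>. x v ^ Poly_Mapping.lookup \<alpha> v))"

text \<open>Affine space over a finite index set \<open>Y\<close> is \<open>Y \<rightarrow>\<^sub>E UNIV\<close>.\<close>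

definition zero_locus :: "'v set \<Rightarrow> (('v \<Rightarrow>\<^sub>0 nat) \<Rightarrow>\<^sub>0 'k::field) set \<Rightarrow> ('v \<Rightarrow> 'k) set" where
  "zero_locus Y I = {x \<in> Y \<rightarrow>\<^sub>E UNIV. \<forall>p \<in> I. poly_value x p = 0}"

definition product_relations :: "nat \<Rightarrow> nat \<Rightarrow> ((ssyt \<Rightarrow>\<^sub>0 nat) \<Rightarrow>\<^sub>0 'k::field) set" where
  "product_relations n m =
     {pvar T1 * pvar T2 - pvar T3 * pvar T4 | T1 T2 T3 T4.
        {T1, T2, T3, T4} \<subseteq> G_cols n m \<and> distinct [T1, T2, T3, T4] \<and> T1 + T2 = T3 + T4}"

definition P_ideal :: "nat \<Rightarrow> nat \<Rightarrow> ((ssyt \<Rightarrow>\<^sub>0 nat) \<Rightarrow>\<^sub>0 'k::field) set" where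
  "P_ideal n m = Idl\<^bsub>poly_ring (E_cols n m)\<^esub> (product_relations n m)"

definition M_ideal :: "nat \<Rightarrow> nat \<Rightarrow> (ssyt \<Rightarrow> 'k) \<Rightarrow> (ssyt \<Rightarrow> 'k) \<Rightarrow> (ssyt \<Rightarrow>\<^sub>0 'k::field) set" where
  "M_ideal n m t t' = Idl\<^bsub>tableaux_algebra n m\<^esub>
     ({Poly_Mapping.single T 1 - Poly_Mapping.single 0 (t T) | T. T \<in> E_cols n m} \<union>
      {Poly_Mapping.single T 1 - Poly_Mapping.single 0 (t' T) | T. T \<in> F_cols n m})"

lemma zero_in_SSYT: "0 \<in> SSYT n m"
  by (simp add: SSYT_def zero_ssyt.rep_eq)

lemma length_star_rows: "length (star_rows T U) = max (length T) (length U)"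
  by (induction T U rule: star_rows.induct) auto

lemma entries_star_rows:
  "(\<Union>r \<in> set (star_rows T U). set r) = (\<Union>r \<in> set T. set r) \<union> (\<Union>r \<in> set U. set r)"
  by (induction T U rule: star_rows.induct) auto

lemma plus_in_SSYT:
  assumes "T \<in> SSYT n m" "U \<in> SSYT n m"
  shows "T + U \<in> SSYT n m"
proof -
  have "T \<in> SSYT n m \<longleftrightarrow> length (rows T) \<le> n \<and> (\<Union>r \<in> set (rows T). set r) \<subseteq> {1..m}" for T
    by (auto simp: SSYT_def)
  with assms show ?thesis
    by (simp add: plus_ssyt.rep_eq length_star_rows entries_star_rows)
qed

lemma cring_tableaux_algebra: "cring (tableaux_algebra n m)"
  unfolding tableaux_algebra_def by (intro cring_monoid_algebra zero_in_SSYT plus_in_SSYT)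

lemma cring_poly_ring: "cring (poly_ring Y)"
  unfolding poly_ring_def by (rule cring_monoid_algebra) (use keys_add in \<open>force+\<close>)

end

theory Submission
  imports Defs
begin

text \<open>
  Both sides of the equation are the kernels of the \<open>K\<close>-algebra homomorphisms from the tableaux
  algebra to \<open>K\<close>, called points below.

  The kernel of a point \<open>\<phi>\<close> is maximal, because the quotient by it is the field \<open>K\<close>. It is the ideal
  \<open>M_ideal n m t t'\<close> whose coordinates are the values of \<open>\<phi>\<close> on the columns
  (\<open>M_ideal_eq_kernel\<close>): every tableau is a sum of columns, so modulo that ideal every element is
  congruent to its value. It remains to determine which tuples are points and to see that every
  maximal ideal is the kernel of a point.

  A tuple of values on the columns extends to a point if and only if it satisfies the product
  relations, that is, these relations present the monoid of tableaux. The proof peels off first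
  columns. The first column of \<open>T + c\<close> is that of \<open>a + c\<close>, where \<open>a\<close> is the first column of \<open>T\<close>. So
  adding \<open>c\<close> to \<open>T\<close> means to straighten the pair \<open>a, c\<close> into \<open>p, q\<close> with \<open>a + c = p + q\<close>, to keep
  \<open>p\<close> in front, and to add \<open>q\<close> to the smaller tableau that is left of \<open>T\<close>. By induction, the
  product of the values of the columns of a tableau is multiplicative (\<open>weight_plus\<close>). Only
  relations among four distinct columns carry information, and those involve the variables in
  \<open>E_cols n m\<close> only (\<open>product_relations_suffice\<close>, \<open>product_relation_in_E\<close>). This is why the
  coordinates at \<open>F_cols n m\<close> are free.

  That every maximal ideal is the kernel of a point is the weak Nullstellensatz for the finitely
  generated algebra at hand. It is proved here over an arbitrary algebraically closed field for a
  prime ideal \<open>M\<close> of a finitely generated \<open>K\<close>-algebra \<open>A\<close> inside a commutative ring. Passing from a subring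
  \<open>R\<close> to \<open>R[x]\<close>, every homomorphism from \<open>R\<close> to \<open>K\<close> that kills \<open>M\<close>, and does not kill a suitable
  element of \<open>R\<close>, extends to \<open>R[x]\<close> without killing a prescribed element outside \<open>M\<close>
  (\<open>hom_extension_step\<close>). Iterating from the inclusion of \<open>K\<close> gives a homomorphism on \<open>A\<close> that
  kills \<open>M\<close>. The ring \<open>A\<close> stands for the domain \<open>A/M\<close> throughout, and equality in that domain is
  expressed by membership in \<open>M\<close>, so that all subrings are subsets of one type.
\<close>

section \<open>Extending homomorphisms to an algebraically closed field\<close>

definition unital_subring :: "'a::comm_ring_1 set \<Rightarrow> bool" where
  "unital_subring R \<longleftrightarrow> 1 \<in> R \<and> (\<forall>a \<in> R. \<forall>b \<in> R. a - b \<in> R \<and> a * b \<in> R)"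

lemma
  assumes R: "unital_subring R"
  shows subring_one: "1 \<in> R" and subring_zero: "0 \<in> R"
    and subring_diff: "a \<in> R \<Longrightarrow> b \<in> R \<Longrightarrow> a - b \<in> R"
    and subring_mult: "a \<in> R \<Longrightarrow> b \<in> R \<Longrightarrow> a * b \<in> R"
    and subring_add: "a \<in> R \<Longrightarrow> b \<in> R \<Longrightarrow> a + b \<in> R"
    and subring_power: "a \<in> R \<Longrightarrow> a ^ N \<in> R"
proof -
  show diff: "a - b \<in> R" and m: "a * b \<in> R" if "a \<in> R" "b \<in> R" for a b
    using R that by (auto simp: unital_subring_def)
  show one: "1 \<in> R" using R by (auto simp: unital_subring_def)
  show z: "0 \<in> R" using diff[OF one one] by simp
  show "a + b \<in> R" if "a \<in> R" "b \<in> R"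
    using diff[OF that(1) diff[OF z that(2)]] by simp
  show "a \<in> R \<Longrightarrow> a ^ N \<in> R" by (induction N) (auto intro: one m)
qed

lemma subring_sum:
  assumes "unital_subring R" "\<And>i. i \<in> I \<Longrightarrow> f i \<in> R"
  shows "sum f I \<in> R"
  using assms(2)
  by (induction I rule: infinite_finite_induct) (auto intro: subring_zero subring_add assms(1))

definition ring_hom_on :: "'a::comm_ring_1 set \<Rightarrow> ('a \<Rightarrow> 'b::comm_ring_1) \<Rightarrow> bool" where
  "ring_hom_on R \<phi> \<longleftrightarrow>
     \<phi> 1 = 1 \<and> (\<forall>a \<in> R. \<forall>b \<in> R. \<phi> (a - b) = \<phi> a - \<phi> b \<and> \<phi> (a * b) = \<phi> a * \<phi> b)"

lemma
  assumes R: "unital_subring R" and h: "ring_hom_on R \<phi>"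
  shows ring_hom_on_one: "\<phi> 1 = 1" and ring_hom_on_zero: "\<phi> 0 = 0"
    and ring_hom_on_diff: "a \<in> R \<Longrightarrow> b \<in> R \<Longrightarrow> \<phi> (a - b) = \<phi> a - \<phi> b"
    and ring_hom_on_mult: "a \<in> R \<Longrightarrow> b \<in> R \<Longrightarrow> \<phi> (a * b) = \<phi> a * \<phi> b"
    and ring_hom_on_add: "a \<in> R \<Longrightarrow> b \<in> R \<Longrightarrow> \<phi> (a + b) = \<phi> a + \<phi> b"
    and ring_hom_on_power: "a \<in> R \<Longrightarrow> \<phi> (a ^ N) = \<phi> a ^ N"
proof -
  show one: "\<phi> 1 = 1" using h by (auto simp: ring_hom_on_def)
  show diff: "\<phi> (a - b) = \<phi> a - \<phi> b" and m: "\<phi> (a * b) = \<phi> a * \<phi> b" if "a \<in> R" "b \<in> R" for a b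
    using h that by (auto simp: ring_hom_on_def)
  show z: "\<phi> 0 = 0" using diff[OF subring_one[OF R] subring_one[OF R]] by simp
  show "\<phi> (a + b) = \<phi> a + \<phi> b" if "a \<in> R" "b \<in> R"
    using diff[OF that(1) subring_diff[OF R subring_zero[OF R] that(2)]]
      diff[OF subring_zero[OF R] that(2)] z by simp
  show "a \<in> R \<Longrightarrow> \<phi> (a ^ N) = \<phi> a ^ N"
    by (induction N) (auto simp: one m subring_power R)
qed

lemma ring_hom_on_sum:
  assumes R: "unital_subring R" and h: "ring_hom_on R \<phi>" and f: "\<And>i. i \<in> I \<Longrightarrow> f i \<in> R"
  shows "\<phi> (sum f I) = (\<Sum>i\<in>I. \<phi> (f i))"
  using f
  by (induction I rule: infinite_finite_induct)
    (auto simp: ring_hom_on_zero[OF R h] ring_hom_on_add[OF R h] subring_sum[OF R])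

definition polys_over :: "'a::comm_ring_1 set \<Rightarrow> 'a poly set" where
  "polys_over R = {p. \<forall>i. coeff p i \<in> R}"

definition adjoin :: "'a::comm_ring_1 set \<Rightarrow> 'a \<Rightarrow> 'a set" where
  "adjoin R x = (\<lambda>p. poly p x) ` polys_over R"

lemma unital_subring_polys_over:
  assumes R: "unital_subring R"
  shows "unital_subring (polys_over R)"
  unfolding unital_subring_def polys_over_def
  by (auto simp: coeff_mult intro!: subring_one subring_zero subring_diff subring_mult subring_sum R
      split: if_splits)

lemma monom_in_polys_over: "unital_subring R \<Longrightarrow> c \<in> R \<Longrightarrow> monom c i \<in> polys_over R"
  by (auto simp: polys_over_def intro: subring_zero)

lemma smult_in_polys_over:
  "unital_subring R \<Longrightarrow> c \<in> R \<Longrightarrow> p \<in> polys_over R \<Longrightarrow> smult c p \<in> polys_over R"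
  by (auto simp: polys_over_def intro: subring_mult)

lemma unital_subring_adjoin:
  assumes R: "unital_subring R"
  shows "unital_subring (adjoin R x)"
proof -
  note P = unital_subring_polys_over[OF R]
  show ?thesis
    unfolding unital_subring_def adjoin_def
    by (auto simp flip: poly_diff poly_mult
        intro!: imageI subring_diff[OF P] subring_mult[OF P] image_eqI[of 1 _ 1] subring_one[OF P])
qed

lemma subset_adjoin:
  assumes R: "unital_subring R"
  shows "R \<subseteq> adjoin R x"
proof
  fix a assume "a \<in> R"
  then show "a \<in> adjoin R x"
    unfolding adjoin_def
    by (intro image_eqI[of _ _ "monom a 0"] monom_in_polys_over R) (simp_all add: poly_monom)
qed

lemma generator_in_adjoin: "unital_subring R \<Longrightarrow> x \<in> adjoin R x"
  unfolding adjoin_def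
  by (intro image_eqI[of _ _ "monom 1 1"] monom_in_polys_over subring_one) (simp_all add: poly_monom)

lemma poly_in_subring:
  assumes A: "unital_subring A" and "R \<subseteq> A" "x \<in> A" "p \<in> polys_over R"
  shows "poly p x \<in> A"
  unfolding poly_altdef
  using assms by (auto simp: polys_over_def intro!: subring_sum subring_mult subring_power)

lemma adjoin_subset: "unital_subring A \<Longrightarrow> R \<subseteq> A \<Longrightarrow> x \<in> A \<Longrightarrow> adjoin R x \<subseteq> A"
  by (auto simp: adjoin_def intro: poly_in_subring)

text \<open>
  Division with remainder after clearing the leading coefficient of the divisor. The bound on the
  degree of the quotient has to be part of the induction: in a ring with zero divisors it does not
  follow from the equation.
\<close>

lemma pseudo_division:
  fixes f g :: "'a::comm_ring_1 poly"
  assumes R: "unital_subring R" and f: "f \<in> polys_over R" "0 < degree f" and g: "g \<in> polys_over R"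
  shows "\<exists>N. \<exists>q \<in> polys_over R. \<exists>r \<in> polys_over R.
           smult (lead_coeff f ^ N) g = q * f + r \<and> degree r < degree f \<and>
           degree q \<le> degree g - degree f"
  using g
proof (induction "degree g" arbitrary: g rule: less_induct)
  case less
  note P = unital_subring_polys_over[OF R]
  show ?case
  proof (cases "degree g < degree f")
    case True
    then show ?thesis
      using less.prems
      by (intro exI[of _ 0] bexI[of _ 0] bexI[of _ g] subring_zero[OF P]) simp_all
  next
    case False
    define a where "a = lead_coeff f"
    define t where "t = monom (lead_coeff g) (degree g - degree f)"
    define g' where "g' = smult a g - t * f"
    have a: "a \<in> R" and lg: "lead_coeff g \<in> R"
      using f less.prems by (auto simp: a_def polys_over_def)
    have t: "t \<in> polys_over R"
      unfolding t_def by (intro monom_in_polys_over R lg)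
    have "degree g' \<le> degree g"
      unfolding g'_def t_def
      by (intro degree_diff_le degree_smult_le order.trans[OF degree_mult_le]
          order.trans[OF add_right_mono[OF degree_monom_le]]) (use False in auto)
    moreover have "coeff g' (degree g) = 0"
      using False by (simp add: g'_def t_def coeff_monom_mult a_def)
    ultimately have deg: "degree g' < degree g"
      using False f(2) by (metis degree_0 leading_coeff_0_iff le_neq_implies_less linorder_not_less)
    have "g' \<in> polys_over R"
      unfolding g'_def using t less.prems f a
      by (intro subring_diff[OF P] subring_mult[OF P] smult_in_polys_over R)
    from less.hyps[OF deg this] obtain N q r where
      q: "q \<in> polys_over R" and r: "r \<in> polys_over R"
      and eq: "smult (a ^ N) g' = q * f + r" and dr: "degree r < degree f"
      and dq: "degree q \<le> degree g' - degree f"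
      unfolding a_def by blast
    define q' where "q' = q + smult (a ^ N) t"
    have "smult (a ^ Suc N) g = smult (a ^ N) (g' + t * f)"
      by (simp add: g'_def mult.commute)
    also have "\<dots> = q' * f + r"
      by (simp add: smult_add_right eq q'_def algebra_simps)
    finally have "smult (a ^ Suc N) g = q' * f + r" .
    moreover have "q' \<in> polys_over R"
      unfolding q'_def using q t a
      by (intro subring_add[OF P] smult_in_polys_over subring_power R)
    moreover have "degree q' \<le> degree g - degree f"
      unfolding q'_def using dq deg
      by (intro degree_add_le order.trans[OF degree_smult_le]) (auto simp: t_def degree_monom_le)
    ultimately show ?thesis
      using r dr unfolding a_def by blast
  qed
qed

lemma
  assumes R: "unital_subring R" and h: "ring_hom_on R \<phi>"
    and p: "p \<in> polys_over R" and q: "q \<in> polys_over R"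
  shows map_poly_hom_diff: "map_poly \<phi> (p - q) = map_poly \<phi> p - map_poly \<phi> q"
    and map_poly_hom_add: "map_poly \<phi> (p + q) = map_poly \<phi> p + map_poly \<phi> q"
    and map_poly_hom_mult: "map_poly \<phi> (p * q) = map_poly \<phi> p * map_poly \<phi> q"
    and map_poly_hom_smult: "c \<in> R \<Longrightarrow> map_poly \<phi> (smult c p) = smult (\<phi> c) (map_poly \<phi> p)"
  using p q
  by (auto intro!: poly_eqI sum.cong simp: polys_over_def coeff_map_poly ring_hom_on_zero[OF R h] ring_hom_on_diff[OF R h]
      ring_hom_on_add[OF R h] ring_hom_on_mult[OF R h] coeff_mult ring_hom_on_sum[OF R h] subring_mult[OF R])

text \<open>
  Sending \<open>x\<close> to \<open>y\<close> is well defined as soon as \<open>y\<close> satisfies the images of all relations of \<open>x\<close>.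
  Asking this for relations modulo \<open>M\<close> makes the extension kill \<open>M\<close>.
\<close>

lemma hom_extends_to_adjoin:
  fixes \<phi> :: "'a::comm_ring_1 \<Rightarrow> 'b::comm_ring_1"
  assumes R: "unital_subring R" and h: "ring_hom_on R \<phi>" and "0 \<in> M"
    and y: "\<And>g. g \<in> polys_over R \<Longrightarrow> poly g x \<in> M \<Longrightarrow> poly (map_poly \<phi> g) y = 0"
  obtains \<phi>' where "ring_hom_on (adjoin R x) \<phi>'" "\<forall>s \<in> adjoin R x \<inter> M. \<phi>' s = 0"
    "\<forall>r \<in> R. \<phi>' r = \<phi> r" "\<And>g. g \<in> polys_over R \<Longrightarrow> \<phi>' (poly g x) = poly (map_poly \<phi> g) y"
proof -
  note P = unital_subring_polys_over[OF R]
  \<comment> \<open>Any representation of an element as a polynomial in x gives the same value.\<close>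
  define \<phi>' where "\<phi>' s = poly (map_poly \<phi> (SOME g. g \<in> polys_over R \<and> poly g x = s)) y" for s
  have eval: "\<phi>' (poly g x) = poly (map_poly \<phi> g) y" if g: "g \<in> polys_over R" for g
  proof -
    define g' where "g' = (SOME g'. g' \<in> polys_over R \<and> poly g' x = poly g x)"
    have g': "g' \<in> polys_over R \<and> poly g' x = poly g x"
      unfolding g'_def by (rule someI[of _ g]) (simp add: g)
    then have "poly (map_poly \<phi> (g' - g)) y = 0"
      using g \<open>0 \<in> M\<close> by (intro y subring_diff[OF P]) auto
    then show ?thesis
      using g g' by (simp add: \<phi>'_def map_poly_hom_diff[OF R h] flip: g'_def)
  qed
  have mono: "\<phi>' r = \<phi> r" if "r \<in> R" for r
    using eval[OF monom_in_polys_over[OF R that, of 0]] ring_hom_on_zero[OF R h]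
    by (simp add: poly_monom map_poly_monom)
  have "ring_hom_on (adjoin R x) \<phi>'"
    unfolding ring_hom_on_def adjoin_def
    by (auto simp: mono[OF subring_one[OF R]] ring_hom_on_one[OF R h] eval subring_diff[OF P] subring_mult[OF P]
        map_poly_hom_diff[OF R h] map_poly_hom_mult[OF R h] simp flip: poly_diff poly_mult)
  moreover have "\<forall>s \<in> adjoin R x \<inter> M. \<phi>' s = 0"
    by (auto simp: adjoin_def eval y)
  ultimately show ?thesis
    using that[of \<phi>'] eval mono by blast
qed

lemma exists_nonroot:
  fixes p :: "'k::alg_closed_field poly"
  assumes "p \<noteq> 0"
  shows "\<exists>y. poly p y \<noteq> 0"
proof (cases "degree p = 0")
  case True
  with assms show ?thesis by (auto elim: degree_eq_zeroE)
next
  case False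
  \<comment> \<open>At a root of p - 1, the value of p is 1.\<close>
  then have "degree (p + [:-1:]) > 0"
    by (subst degree_add_eq_left) auto
  then obtain y where "poly (p + [:-1:]) y = 0"
    using alg_closed_imp_poly_has_root by blast
  then show ?thesis by (intro exI[of _ y]) auto
qed

locale prime_of_subring =
  fixes A M :: "'a::comm_ring_1 set"
  assumes subring_A: "unital_subring A" and M_subset: "M \<subseteq> A"
    and M_zero: "0 \<in> M" and M_add: "a \<in> M \<Longrightarrow> b \<in> M \<Longrightarrow> a + b \<in> M"
    and M_mult: "a \<in> A \<Longrightarrow> b \<in> M \<Longrightarrow> a * b \<in> M"
    and M_prime: "a \<in> A \<Longrightarrow> b \<in> A \<Longrightarrow> a * b \<in> M \<Longrightarrow> a \<in> M \<or> b \<in> M"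
    and one_notin_M: "1 \<notin> M"
begin

lemma M_diff: "a \<in> M \<Longrightarrow> b \<in> M \<Longrightarrow> a - b \<in> M"
  using M_add[OF _ M_mult[of "-1" b]] subring_diff[OF subring_A subring_zero subring_one] subring_A
  by auto

lemma M_sum: "(\<And>i. i \<in> I \<Longrightarrow> f i \<in> M) \<Longrightarrow> sum f I \<in> M"
  by (induction I rule: infinite_finite_induct) (auto intro: M_zero M_add)

lemma power_notin_M: "a \<in> A \<Longrightarrow> a \<notin> M \<Longrightarrow> a ^ N \<notin> M"
  by (induction N) (auto simp: one_notin_M dest: M_prime subring_power[OF subring_A])

lemma poly_value_in_M:
  assumes "p \<in> polys_over M" "x \<in> A"
  shows "poly p x \<in> M"
  unfolding poly_altdef
  using assms
  by (intro M_sum, subst mult.commute)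
    (auto simp: polys_over_def intro!: M_mult subring_power subring_A)

text \<open>
  Peel off leading terms: by minimality the leading coefficient of \<open>g\<close> lies in \<open>M\<close>, and the
  polynomial without its leading term is a relation of smaller degree.
\<close>

lemma relation_coeffs_in_M:
  assumes R: "unital_subring R" "R \<subseteq> A" and x: "x \<in> A"
    and g: "g \<in> polys_over R" "poly g x \<in> M"
    and min: "\<And>f. f \<in> polys_over R \<Longrightarrow> lead_coeff f \<notin> M \<Longrightarrow> poly f x \<in> M \<Longrightarrow> degree g < degree f"
  shows "g \<in> polys_over M"
  using g min
proof (induction "degree g" arbitrary: g rule: less_induct)
  case less
  note P = unital_subring_polys_over[OF R(1)]
  have lg: "lead_coeff g \<in> M" using less.prems by blast
  show ?case
  proof (cases "degree g = 0")
    case True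
    then obtain c where "g = [:c:]" by (auto elim: degree_eq_zeroE)
    then show ?thesis
      using lg M_zero by (auto simp: polys_over_def coeff_pCons split: nat.splits)
  next
    case False
    define t where "t = monom (lead_coeff g) (degree g)"
    define g' where "g' = g - t"
    have t: "t \<in> polys_over R" and tM: "t \<in> polys_over M"
      using less.prems(1) lg M_zero subring_zero[OF R(1)] by (auto simp: t_def polys_over_def)
    have "degree g' \<le> degree g" "coeff g' (degree g) = 0"
      by (auto simp: g'_def t_def degree_monom_le intro!: degree_diff_le)
    then have deg: "degree g' < degree g"
      using False by (metis degree_0 leading_coeff_0_iff le_neq_implies_less)
    have "g' \<in> polys_over M"
      using deg less.prems poly_value_in_M[OF tM x]
      by (intro less.hyps) (force simp: g'_def intro!: subring_diff[OF P] t M_diff)+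
    then have "coeff g' i + coeff t i \<in> M" for i
      using tM by (intro M_add) (auto simp: polys_over_def)
    then show ?thesis by (simp add: g'_def polys_over_def)
  qed
qed

text \<open>
  In the domain \<open>A/M\<close> with \<open>x\<close> algebraic over \<open>R\<close>, every nonzero \<open>b\<close> in \<open>R[x]\<close> divides a nonzero
  constant of \<open>R\<close>. Among the polynomials whose value at \<open>x\<close> is a nonzero multiple of \<open>b\<close>, take \<open>g\<close> of
  least degree. Dividing \<open>g\<close> by the minimal relation \<open>f\<close> shows \<open>degree g < degree f\<close>. If \<open>g\<close> were
  not constant, then dividing \<open>f\<close> by \<open>g\<close> would leave a remainder that vanishes, so that a multiple of
  \<open>f\<close> would be \<open>q * g\<close>; since \<open>g\<close> does not vanish at \<open>x\<close>, the quotient \<open>q\<close> would be a relation of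
  degree smaller than that of \<open>f\<close>.
\<close>

lemma divides_constant_mod_M:
  assumes R: "unital_subring R" "R \<subseteq> A" and x: "x \<in> A" and b: "b \<in> adjoin R x" "b \<notin> M"
    and f: "f \<in> polys_over R" "lead_coeff f \<notin> M" "poly f x \<in> M" "0 < degree f"
    and min: "\<And>g. g \<in> polys_over R \<Longrightarrow> lead_coeff g \<notin> M \<Longrightarrow> poly g x \<in> M \<Longrightarrow> degree f \<le> degree g"
  shows "\<exists>c \<in> R - M. \<exists>s \<in> adjoin R x. b * s - c \<in> M"
proof -
  note P = unital_subring_polys_over[OF R(1)] and S = unital_subring_adjoin[OF R(1), of x]
  have SA: "adjoin R x \<subseteq> A" by (intro adjoin_subset subring_A R x)
  have val: "poly p x \<in> adjoin R x" if "p \<in> polys_over R" for p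
    using that by (auto simp: adjoin_def)
  define Q where "Q = {g \<in> polys_over R. poly g x \<notin> M \<and> (\<exists>s \<in> adjoin R x. b * s - poly g x \<in> M)}"
  obtain h where h: "h \<in> polys_over R" "b = poly h x" using b(1) by (auto simp: adjoin_def)
  have "h \<in> Q"
    using h b M_zero subring_one[OF S] by (auto simp: Q_def intro!: bexI[of _ 1])
  then obtain g where gQ: "g \<in> Q" and gmin: "\<And>g'. g' \<in> Q \<Longrightarrow> degree g \<le> degree g'"
    using ex_has_least_nat[of "\<lambda>g. g \<in> Q" h degree] by blast
  from gQ obtain s where g: "g \<in> polys_over R" "poly g x \<notin> M" and s: "s \<in> adjoin R x" "b * s - poly g x \<in> M"
    by (auto simp: Q_def)
  have lcR: "lead_coeff p \<in> R" if "p \<in> polys_over R" for p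
    using that by (auto simp: polys_over_def)
  have "degree g = 0"
  proof (rule ccontr)
    assume pos: "degree g \<noteq> 0"
    \<comment> \<open>Otherwise dropping the leading term of g would give a smaller element of Q.\<close>
    have lg: "lead_coeff g \<notin> M"
    proof
      assume l: "lead_coeff g \<in> M"
      define t where "t = monom (lead_coeff g) (degree g)"
      define g' where "g' = g - t"
      have t: "t \<in> polys_over R" and tM: "t \<in> polys_over M"
        using g(1) l M_zero subring_zero[OF R(1)] by (auto simp: t_def polys_over_def)
      note tx = poly_value_in_M[OF tM x]
      have "degree g' \<le> degree g" "coeff g' (degree g) = 0"
        by (auto simp: g'_def t_def degree_monom_le intro!: degree_diff_le)
      then have deg: "degree g' < degree g"
        using pos by (metis degree_0 leading_coeff_0_iff le_neq_implies_less)
      have "g' \<in> polys_over R" using g t by (auto simp: g'_def intro!: subring_diff[OF P])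
      moreover have "poly g' x \<notin> M" using g(2) M_add[OF _ tx, of "poly g' x"] by (auto simp: g'_def)
      moreover have "b * s - poly g' x \<in> M"
        using M_add[OF s(2) tx] by (simp add: g'_def algebra_simps)
      ultimately have "g' \<in> Q" using s by (auto simp: Q_def)
      from gmin[OF this] deg show False by simp
    qed
    have deg: "degree g < degree f"
    proof (rule ccontr)
      assume "\<not> degree g < degree f"
      obtain N q r where q: "q \<in> polys_over R" and r: "r \<in> polys_over R" "degree r < degree f"
        and eq: "smult (lead_coeff f ^ N) g = q * f + r"
        using pseudo_division[OF R(1) f(1,4) g(1)] by blast
      define l where "l = lead_coeff f ^ N"
      have l: "l \<in> R" "l \<notin> M"
        unfolding l_def using lcR[OF f(1)] R(2)
        by (auto intro: subring_power[OF R(1)] dest!: power_notin_M[OF _ f(2), of N])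
      have ex: "l * poly g x = poly q x * poly f x + poly r x"
        using arg_cong[OF eq, of "\<lambda>p. poly p x"] by (simp add: l_def)
      have qf: "poly q x * poly f x \<in> M" using val[OF q] SA f(3) by (auto intro: M_mult)
      have "l * poly g x \<notin> M"
        using M_prime[of l "poly g x"] l R(2) g val[OF g(1)] SA by blast
      then have rM: "poly r x \<notin> M" using ex M_add[OF qf] by auto
      have "b * (l * s) - poly r x = l * (b * s - poly g x) + poly q x * poly f x"
        using ex by (simp add: algebra_simps)
      also have "\<dots> \<in> M" using l R(2) s(2) by (intro M_add[OF M_mult qf]) auto
      finally have "r \<in> Q"
        using rM r s(1) l(1) subset_adjoin[OF R(1), of x]
        by (auto simp: Q_def intro!: bexI[of _ "l * s"] subring_mult[OF S])
      from gmin[OF this] r(2) \<open>\<not> degree g < degree f\<close> show False by simp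
    qed
    obtain N q r where q: "q \<in> polys_over R" "degree q \<le> degree f - degree g"
      and r: "r \<in> polys_over R" "degree r < degree g"
      and eq: "smult (lead_coeff g ^ N) f = q * g + r"
      using pseudo_division[OF R(1) g(1) _ f(1)] pos by blast
    define l where "l = lead_coeff g ^ N"
    have l: "l \<in> R" "l \<notin> M"
      unfolding l_def using lcR[OF g(1)] R(2)
      by (auto intro: subring_power[OF R(1)] dest!: power_notin_M[OF _ lg, of N])
    have ex: "l * poly f x = poly q x * poly g x + poly r x"
      using arg_cong[OF eq, of "\<lambda>p. poly p x"] by (simp add: l_def)
    have lf: "l * poly f x \<in> M" using l R(2) f(3) by (auto intro: M_mult)
    have rM: "poly r x \<in> M"
    proof (rule ccontr)
      assume rM: "poly r x \<notin> M"
      have "b * (- poly q x * s) - poly r x = - poly q x * (b * s - poly g x) - l * poly f x"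
        using ex by (simp add: algebra_simps)
      also have "\<dots> \<in> M"
        using SA val[OF q(1)] s(2) subring_diff[OF subring_A subring_zero[OF subring_A], of "poly q x"]
        by (intro M_diff[OF M_mult lf]) auto
      finally have "r \<in> Q"
        using rM r s(1) subring_diff[OF S subring_zero[OF S] val[OF q(1)]]
        unfolding Q_def by (auto intro!: bexI[of _ "- poly q x * s"] subring_mult[OF S])
      from gmin[OF this] r(2) show False by simp
    qed
    have "poly q x * poly g x \<in> M" using M_diff[OF lf rM] ex by simp
    then have qM: "poly q x \<in> M" using M_prime val[OF q(1)] val[OF g(1)] SA g(2) by blast
    have "q \<in> polys_over M"
      by (rule relation_coeffs_in_M[OF R x q(1) qM]) (use q(2) min pos deg in force)
    \<comment> \<open>But this coefficient is the one of the multiple of f, a product of elements outside M.\<close>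
    then have "coeff (q * g) (degree f) \<in> M"
      using g(1) R(2) unfolding coeff_mult
      by (intro M_sum, subst mult.commute) (auto simp: polys_over_def intro!: M_mult)
    moreover have "coeff (q * g) (degree f) = l * lead_coeff f"
      using arg_cong[OF eq, of "\<lambda>p. coeff p (degree f)"] r(2) deg by (simp add: coeff_eq_0 l_def)
    ultimately show False
      using M_prime[of l "lead_coeff f"] l R(2) f(2) lcR[OF f(1)] by auto
  qed
  then obtain c where "g = [:c:]" by (auto elim: degree_eq_zeroE)
  then show ?thesis
    using g s lcR[OF g(1)] by auto
qed

text \<open>
  If \<open>x\<close> is transcendental over \<open>R\<close> modulo \<open>M\<close>, any \<open>y\<close> may be chosen as image of \<open>x\<close>. It has to
  avoid the roots of the image of a polynomial representing \<open>b\<close>, and that image is nonzero if \<open>\<phi>\<close>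
  does not kill some coefficient. If \<open>x\<close> is algebraic, let \<open>y\<close> be a root of the image of the minimal
  relation \<open>f\<close>. When \<open>\<phi>\<close> does not kill the leading coefficient of \<open>f\<close>, division by \<open>f\<close> shows that \<open>y\<close>
  satisfies all relations of \<open>x\<close>. When moreover \<open>\<phi>\<close> does not kill a constant that \<open>b\<close> divides, no
  extension can kill \<open>b\<close>.
\<close>

lemma hom_extension_step:
  assumes R: "unital_subring R" "R \<subseteq> A" and x: "x \<in> A" and b: "b \<in> adjoin R x" "b \<notin> M"
  shows "\<exists>a \<in> R - M. \<forall>\<phi> :: 'a \<Rightarrow> 'k::alg_closed_field.
           ring_hom_on R \<phi> \<longrightarrow> (\<forall>r \<in> R \<inter> M. \<phi> r = 0) \<longrightarrow> \<phi> a \<noteq> 0 \<longrightarrow>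
           (\<exists>\<phi>'. ring_hom_on (adjoin R x) \<phi>' \<and> (\<forall>s \<in> adjoin R x \<inter> M. \<phi>' s = 0) \<and>
                 (\<forall>r \<in> R. \<phi>' r = \<phi> r) \<and> \<phi>' b \<noteq> 0)"
proof (cases "\<exists>f. f \<in> polys_over R \<and> lead_coeff f \<notin> M \<and> poly f x \<in> M")
  case False
  obtain h where h: "h \<in> polys_over R" "b = poly h x" using b(1) by (auto simp: adjoin_def)
  then obtain i where i: "coeff h i \<in> R - M"
    using poly_value_in_M[OF _ x, of h] b(2) by (auto simp: polys_over_def)
  show ?thesis
  proof (intro bexI[of _ "coeff h i"] allI impI i)
    fix \<phi> :: "'a \<Rightarrow> 'k"
    assume \<phi>: "ring_hom_on R \<phi>" "\<forall>r \<in> R \<inter> M. \<phi> r = 0" and nz: "\<phi> (coeff h i) \<noteq> 0"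
    have "coeff (map_poly \<phi> h) i \<noteq> 0"
      using nz by (simp add: coeff_map_poly ring_hom_on_zero[OF R(1) \<phi>(1)])
    then have "map_poly \<phi> h \<noteq> 0" by auto
    then obtain y where y: "poly (map_poly \<phi> h) y \<noteq> 0" using exists_nonroot by blast
    have "poly (map_poly \<phi> g) y = 0" if g: "g \<in> polys_over R" "poly g x \<in> M" for g
    proof -
      have "g \<in> polys_over M"
        using relation_coeffs_in_M[OF R x g] False by blast
      then have "map_poly \<phi> g = 0"
        using g(1) \<phi>(2)
        by (intro poly_eqI) (auto simp: polys_over_def coeff_map_poly ring_hom_on_zero[OF R(1) \<phi>(1)])
      then show ?thesis by simp
    qed
    from hom_extends_to_adjoin[OF R(1) \<phi>(1) M_zero this] obtain \<phi>'
      where "ring_hom_on (adjoin R x) \<phi>'" "\<forall>s \<in> adjoin R x \<inter> M. \<phi>' s = 0"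
        "\<forall>r \<in> R. \<phi>' r = \<phi> r" "\<And>g. g \<in> polys_over R \<Longrightarrow> \<phi>' (poly g x) = poly (map_poly \<phi> g) y"
      by metis
    with h y show "\<exists>\<phi>'. ring_hom_on (adjoin R x) \<phi>' \<and> (\<forall>s \<in> adjoin R x \<inter> M. \<phi>' s = 0) \<and>
                 (\<forall>r \<in> R. \<phi>' r = \<phi> r) \<and> \<phi>' b \<noteq> 0"
      by (intro exI[of _ \<phi>']) auto
  qed
next
  case True
  then obtain f where f: "f \<in> polys_over R" "lead_coeff f \<notin> M" "poly f x \<in> M"
    and min: "\<And>g. g \<in> polys_over R \<Longrightarrow> lead_coeff g \<notin> M \<Longrightarrow> poly g x \<in> M \<Longrightarrow> degree f \<le> degree g"
    using ex_has_least_nat[of "\<lambda>f. f \<in> polys_over R \<and> lead_coeff f \<notin> M \<and> poly f x \<in> M" _ degree]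
    by blast
  have df: "0 < degree f"
    using f(2,3) by (auto intro!: gr0I elim: degree_eq_zeroE)
  obtain c s where c: "c \<in> R" "c \<notin> M" and s: "s \<in> adjoin R x" "b * s - c \<in> M"
    using divides_constant_mod_M[OF R x b f df min] by blast
  define l where "l = lead_coeff f"
  have l: "l \<in> R" "l \<notin> M" using f by (auto simp: l_def polys_over_def)
  show ?thesis
  proof (intro bexI[of _ "l * c"] allI impI)
    show "l * c \<in> R - M"
      using l c M_prime[of l c] R by (auto intro: subring_mult[OF R(1)])
    fix \<phi> :: "'a \<Rightarrow> 'k"
    assume \<phi>: "ring_hom_on R \<phi>" "\<forall>r \<in> R \<inter> M. \<phi> r = 0" and nz: "\<phi> (l * c) \<noteq> 0"
    have nz: "\<phi> l \<noteq> 0" "\<phi> c \<noteq> 0" using nz l c by (auto simp: ring_hom_on_mult[OF R(1) \<phi>(1)])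
    have "coeff (map_poly \<phi> f) (degree f) \<noteq> 0"
      using nz by (simp add: coeff_map_poly ring_hom_on_zero[OF R(1) \<phi>(1)] l_def)
    then have "0 < degree (map_poly \<phi> f)" using df le_degree by fastforce
    then obtain y where y: "poly (map_poly \<phi> f) y = 0"
      using alg_closed_imp_poly_has_root by blast
    have "poly (map_poly \<phi> g) y = 0" if g: "g \<in> polys_over R" "poly g x \<in> M" for g
    proof -
      note P = unital_subring_polys_over[OF R(1)]
      obtain N q r where q: "q \<in> polys_over R" and r: "r \<in> polys_over R" "degree r < degree f"
        and eq: "smult (l ^ N) g = q * f + r"
        using pseudo_division[OF R(1) f(1) df g(1)] unfolding l_def by blast
      have lN: "l ^ N \<in> R" by (intro subring_power R l)
      have ex: "poly r x = l ^ N * poly g x - poly q x * poly f x"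
        using arg_cong[OF eq, of "\<lambda>p. poly p x"] by simp
      have "poly r x \<in> M"
        unfolding ex using lN R(2) g(2) f(3) poly_in_subring[OF subring_A R(2) x q]
        by (intro M_diff M_mult) auto
      then have "r \<in> polys_over M"
        by (intro relation_coeffs_in_M[OF R x r(1)]) (use r(2) min in force)+
      then have r0: "map_poly \<phi> r = 0"
        using r(1) \<phi>(2)
        by (intro poly_eqI) (auto simp: polys_over_def coeff_map_poly ring_hom_on_zero[OF R(1) \<phi>(1)])
      have "smult (\<phi> l ^ N) (map_poly \<phi> g) = map_poly \<phi> q * map_poly \<phi> f"
        using arg_cong[OF eq, of "map_poly \<phi>"] g(1) q f(1) r(1) r0 lN l(1)
        by (simp add: map_poly_hom_smult[OF R(1) \<phi>(1) g(1) g(1)]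
            map_poly_hom_add[OF R(1) \<phi>(1) subring_mult[OF P]]
            map_poly_hom_mult[OF R(1) \<phi>(1)] ring_hom_on_power[OF R(1) \<phi>(1)])
      from arg_cong[OF this, of "\<lambda>p. poly p y"] show ?thesis
        using y nz by simp
    qed
    from hom_extends_to_adjoin[OF R(1) \<phi>(1) M_zero this] obtain \<phi>'
      where \<phi>': "ring_hom_on (adjoin R x) \<phi>'" "\<forall>s \<in> adjoin R x \<inter> M. \<phi>' s = 0"
        "\<forall>r \<in> R. \<phi>' r = \<phi> r"
      by metis
    note S = unital_subring_adjoin[OF R(1), of x]
    have cS: "c \<in> adjoin R x" using c subset_adjoin[OF R(1)] by auto
    have "\<phi>' (b * s - c) = 0"
      using \<phi>'(2) s b cS by (auto intro!: subring_diff[OF S] subring_mult[OF S])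
    then have "\<phi>' b * \<phi>' s = \<phi> c"
      using s(1) b(1) cS c(1) \<phi>'(3)
      by (simp add: ring_hom_on_diff[OF S \<phi>'(1)] ring_hom_on_mult[OF S \<phi>'(1)] subring_mult[OF S])
    then have "\<phi>' b \<noteq> 0" using nz by auto
    with \<phi>' show "\<exists>\<phi>'. ring_hom_on (adjoin R x) \<phi>' \<and> (\<forall>s \<in> adjoin R x \<inter> M. \<phi>' s = 0) \<and>
                 (\<forall>r \<in> R. \<phi>' r = \<phi> r) \<and> \<phi>' b \<noteq> 0"
      by blast
  qed
qed

end

fun adjoins :: "'a::comm_ring_1 set \<Rightarrow> 'a list \<Rightarrow> 'a set" where
  "adjoins R [] = R"
| "adjoins R (x # xs) = adjoins (adjoin R x) xs"

lemma unital_subring_adjoins: "unital_subring R \<Longrightarrow> unital_subring (adjoins R xs)"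
  by (induction xs arbitrary: R) (auto intro: unital_subring_adjoin)

lemma subset_adjoins: "unital_subring R \<Longrightarrow> R \<subseteq> adjoins R xs"
  by (induction xs arbitrary: R) (use subset_adjoin unital_subring_adjoin in fastforce)+

lemma generators_in_adjoins: "unital_subring R \<Longrightarrow> set xs \<subseteq> adjoins R xs"
  by (induction xs arbitrary: R)
    (auto intro: unital_subring_adjoin dest: generator_in_adjoin[THEN subset_adjoins[THEN subsetD, rotated]])

context prime_of_subring
begin

text \<open>
  The element \<open>a\<close> is found by descending through the generators, and then the homomorphism is
  extended by ascending through them. The element that an extension must not kill is the reason for
  the form of the one-step version.
\<close>

lemma hom_extension:
  assumes "unital_subring R" "R \<subseteq> A" "set xs \<subseteq> A" "b \<in> adjoins R xs" "b \<notin> M"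
  shows "\<exists>a \<in> R - M. \<forall>\<phi> :: 'a \<Rightarrow> 'k::alg_closed_field.
           ring_hom_on R \<phi> \<longrightarrow> (\<forall>r \<in> R \<inter> M. \<phi> r = 0) \<longrightarrow> \<phi> a \<noteq> 0 \<longrightarrow>
           (\<exists>\<phi>'. ring_hom_on (adjoins R xs) \<phi>' \<and> (\<forall>s \<in> adjoins R xs \<inter> M. \<phi>' s = 0) \<and>
                 (\<forall>r \<in> R. \<phi>' r = \<phi> r) \<and> \<phi>' b \<noteq> 0)"
  using assms
proof (induction xs arbitrary: R)
  case Nil
  then show ?case by (intro bexI[of _ b]) auto
next
  case (Cons x xs)
  have R: "unital_subring R" "R \<subseteq> A" and x: "x \<in> A" using Cons.prems by auto
  note S = unital_subring_adjoin[OF R(1), of x]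
  have SA: "adjoin R x \<subseteq> A" by (intro adjoin_subset subring_A R x)
  obtain b' where b': "b' \<in> adjoin R x" "b' \<notin> M"
    and ext': "\<And>\<phi> :: 'a \<Rightarrow> 'k. ring_hom_on (adjoin R x) \<phi> \<Longrightarrow> (\<forall>s \<in> adjoin R x \<inter> M. \<phi> s = 0) \<Longrightarrow> \<phi> b' \<noteq> 0 \<Longrightarrow>
       \<exists>\<phi>'. ring_hom_on (adjoins R (x # xs)) \<phi>' \<and> (\<forall>s \<in> adjoins R (x # xs) \<inter> M. \<phi>' s = 0) \<and>
                 (\<forall>r \<in> adjoin R x. \<phi>' r = \<phi> r) \<and> \<phi>' b \<noteq> 0"
    using Cons.IH[OF S SA] Cons.prems by auto
  obtain a where a: "a \<in> R - M"
    and ext: "\<And>\<phi> :: 'a \<Rightarrow> 'k. ring_hom_on R \<phi> \<Longrightarrow> (\<forall>r \<in> R \<inter> M. \<phi> r = 0) \<Longrightarrow> \<phi> a \<noteq> 0 \<Longrightarrow>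
           \<exists>\<phi>'. ring_hom_on (adjoin R x) \<phi>' \<and> (\<forall>s \<in> adjoin R x \<inter> M. \<phi>' s = 0) \<and>
                 (\<forall>r \<in> R. \<phi>' r = \<phi> r) \<and> \<phi>' b' \<noteq> 0"
    using hom_extension_step[OF R x b'] by blast
  show ?case
  proof (intro bexI[OF _ a] allI impI)
    fix \<phi> :: "'a \<Rightarrow> 'k"
    assume "ring_hom_on R \<phi>" "\<forall>r \<in> R \<inter> M. \<phi> r = 0" "\<phi> a \<noteq> 0"
    from ext[OF this] obtain \<phi>1 where 1: "ring_hom_on (adjoin R x) \<phi>1" "\<forall>s \<in> adjoin R x \<inter> M. \<phi>1 s = 0"
      "\<phi>1 b' \<noteq> 0" "\<forall>r \<in> R. \<phi>1 r = \<phi> r" by blast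
    show "\<exists>\<phi>'. ring_hom_on (adjoins R (x # xs)) \<phi>' \<and> (\<forall>s \<in> adjoins R (x # xs) \<inter> M. \<phi>' s = 0) \<and>
                 (\<forall>r \<in> R. \<phi>' r = \<phi> r) \<and> \<phi>' b \<noteq> 0"
      using ext'[OF 1(1-3)] 1(4) subset_adjoin[OF R(1), of x] by fastforce
  qed
qed

text \<open>
  The weak Nullstellensatz. The extension is applied to \<open>b = 1\<close> and to the inverse of the embedding
  \<open>\<iota>\<close>, which is injective modulo \<open>M\<close> since nonzero constants are units.
\<close>

theorem nullstellensatz:
  fixes \<iota> :: "'k::alg_closed_field \<Rightarrow> 'a"
  assumes \<iota>: "ring_hom_on UNIV \<iota>" "range \<iota> \<subseteq> A" and gen: "set xs \<subseteq> A" "A = adjoins (range \<iota>) xs"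
  shows "\<exists>\<phi> :: 'a \<Rightarrow> 'k. ring_hom_on A \<phi> \<and> (\<forall>s \<in> M. \<phi> s = 0) \<and> (\<forall>c. \<phi> (\<iota> c) = c)"
proof -
  have U: "unital_subring (UNIV :: 'k set)" by (simp add: unital_subring_def)
  note [simp] = ring_hom_on_one[OF U \<iota>(1)] ring_hom_on_diff[OF U \<iota>(1) UNIV_I UNIV_I]
    ring_hom_on_mult[OF U \<iota>(1) UNIV_I UNIV_I] ring_hom_on_zero[OF U \<iota>(1)]
  have R: "unital_subring (range \<iota>)"
    unfolding unital_subring_def
    by (auto simp flip: ring_hom_on_one[OF U \<iota>(1)] ring_hom_on_diff[OF U \<iota>(1) UNIV_I UNIV_I] ring_hom_on_mult[OF U \<iota>(1) UNIV_I UNIV_I])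
  have inj_M: "c = 0" if "\<iota> c \<in> M" for c
  proof (rule ccontr)
    assume "c \<noteq> 0"
    then have "\<iota> (inverse c) * \<iota> c = 1"
      by (simp flip: ring_hom_on_mult[OF U \<iota>(1) UNIV_I UNIV_I] ring_hom_on_one[OF U \<iota>(1)])
    with M_mult[of "\<iota> (inverse c)", OF _ that] \<iota>(2) one_notin_M show False by auto
  qed
  have "inj \<iota>"
  proof (rule injI)
    fix c d assume "\<iota> c = \<iota> d"
    then have "\<iota> (c - d) \<in> M" using M_zero by simp
    from inj_M[OF this] show "c = d" by simp
  qed
  then have [simp]: "inv_into UNIV \<iota> (\<iota> c) = c" for c by simp
  have \<phi>: "ring_hom_on (range \<iota>) (inv_into UNIV \<iota>)"
    unfolding ring_hom_on_def
    by (auto simp flip: ring_hom_on_one[OF U \<iota>(1)] ring_hom_on_diff[OF U \<iota>(1) UNIV_I UNIV_I] ring_hom_on_mult[OF U \<iota>(1) UNIV_I UNIV_I])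
  obtain a where a: "a \<in> range \<iota>" "a \<notin> M" and ext: "\<forall>\<phi> :: 'a \<Rightarrow> 'k.
           ring_hom_on (range \<iota>) \<phi> \<longrightarrow> (\<forall>r \<in> range \<iota> \<inter> M. \<phi> r = 0) \<longrightarrow> \<phi> a \<noteq> 0 \<longrightarrow>
           (\<exists>\<phi>'. ring_hom_on A \<phi>' \<and> (\<forall>s \<in> A \<inter> M. \<phi>' s = 0) \<and>
                 (\<forall>r \<in> range \<iota>. \<phi>' r = \<phi> r) \<and> \<phi>' 1 \<noteq> 0)"
    using hom_extension[OF R \<iota>(2) gen(1), of 1, folded gen(2), OF subring_one[OF subring_A] one_notin_M]
    by blast
  have "inv_into UNIV \<iota> a \<noteq> 0" using a M_zero by auto
  with ext \<phi> inj_M obtain \<phi>' :: "'a \<Rightarrow> 'k" where "ring_hom_on A \<phi>'" "\<forall>s \<in> A \<inter> M. \<phi>' s = 0"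
     "\<forall>r \<in> range \<iota>. \<phi>' r = inv_into UNIV \<iota> r"
    by (auto simp: image_iff)
  then show ?thesis using M_subset by (intro exI[of _ \<phi>']) auto
qed

end

section \<open>Tableaux as sums of columns\<close>

text \<open>
  Since rows are sorted, a tableau is determined by the multisets of its rows, and these add up under
  the star operation. This turns equations between sums of tableaux into equations of multisets.
\<close>

definition row_mset :: "nat list list \<Rightarrow> nat \<Rightarrow> nat multiset" where
  "row_mset T i = (if i < length T then mset (T ! i) else {#})"

lemma row_mset_star_rows: "row_mset (star_rows T U) i = row_mset T i + row_mset U i"
proof (induction T U arbitrary: i rule: star_rows.induct)
  case (3 r T s U)
  have Cons: "row_mset (x # X) i = (case i of 0 \<Rightarrow> mset x | Suc j \<Rightarrow> row_mset X j)" for x X i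
    by (simp add: row_mset_def split: nat.splits)
  show ?case by (simp add: Cons 3 split: nat.splits)
qed (auto simp: row_mset_def)

lemma rows_determined_by_row_msets:
  assumes ssyt: "is_ssyt U" "is_ssyt V" and row: "\<And>i. row_mset U i = row_mset V i"
  shows "U = V"
proof -
  have nonempty: "length X \<le> i \<longleftrightarrow> row_mset X i = {#}" if "is_ssyt X" for X i
    using that by (auto simp: row_mset_def is_ssyt_def not_le)
  have "length U \<le> i \<longleftrightarrow> length V \<le> i" for i
    using ssyt row by (simp add: nonempty)
  then have len: "length U = length V" by (metis order_antisym order_refl)
  then show "U = V"
  proof (rule nth_equalityI)
    fix i assume i: "i < length U"
    then have "sorted (U ! i)" "sorted (V ! i)" using ssyt len by (auto simp: is_ssyt_def)
    moreover have "mset (U ! i) = mset (V ! i)"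
      using row[of i] i len by (simp add: row_mset_def)
    ultimately show "U ! i = V ! i" by (metis properties_for_sort)
  qed
qed

lemma ssyt_plus_left_cancel:
  fixes T U V :: ssyt
  shows "T + U = T + V \<Longrightarrow> U = V"
proof transfer
  fix T U V assume "is_ssyt U" "is_ssyt V" and eq: "star_rows T U = star_rows T V"
  moreover have "row_mset U i = row_mset V i" for i
    using arg_cong[OF eq, of "\<lambda>X. row_mset X i"] by (simp add: row_mset_star_rows)
  ultimately show "U = V" by (intro rows_determined_by_row_msets)
qed

fun strip_rows :: "nat list list \<Rightarrow> nat list list" where
  "strip_rows [] = []"
| "strip_rows (r # T) = (if tl r = [] then [] else tl r # strip_rows T)"

lemma is_ssyt_head_rows:
  "is_ssyt T \<Longrightarrow> is_ssyt (map (\<lambda>r. [hd r]) T)"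
proof (induction T)
  case (Cons r T)
  then have "r \<noteq> []" "1 \<le> hd r" by (auto simp: is_ssyt_Cons)
  with Cons show ?case
    by (cases T) (auto simp: is_ssyt_Cons row_above_def hd_conv_nth)
qed (simp add: is_ssyt_Nil)

lemma is_ssyt_strip_rows: "is_ssyt T \<Longrightarrow> is_ssyt (strip_rows T)"
proof (induction T)
  case (Cons r T)
  then have "sorted (tl r)" "\<forall>a \<in> set (tl r). 1 \<le> a"
    by (auto simp: is_ssyt_Cons sorted_tl dest: list.set_sel(2)[rotated])
  with Cons show ?case
    by (cases T) (auto simp: is_ssyt_Cons is_ssyt_Nil row_above_def nth_tl)
qed simp

lemma star_rows_head_strip:
  "is_ssyt T \<Longrightarrow> star_rows (map (\<lambda>r. [hd r]) T) (strip_rows T) = T"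
proof (induction T)
  case (Cons r T)
  show ?case
  proof (cases "tl r = []")
    case True
    then have "length r = 1" using Cons.prems by (cases r) (auto simp: is_ssyt_Cons)
    then show ?thesis
      using True rows_one_column[OF Cons.prems] by (simp add: comp_def)
  next
    case False
    have "r \<noteq> []" "sorted r" using Cons.prems by (auto simp: is_ssyt_Cons)
    then have "sort ([hd r] @ tl r) = r" by (simp add: sorted_sort_id del: sort_key_simps)
    then show ?thesis using False Cons by (simp add: is_ssyt_Cons sorted_sort_id)
  qed
qed simp

lift_definition head_col :: "ssyt \<Rightarrow> ssyt" is "map (\<lambda>r. [hd r])"
  by (rule is_ssyt_head_rows)

lift_definition tail_cols :: "ssyt \<Rightarrow> ssyt" is strip_rows
  by (rule is_ssyt_strip_rows)

lemma head_plus_tail: "head_col T + tail_cols T = T"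
  by transfer (rule star_rows_head_strip)

lemma hd_sort_append:
  assumes "sorted r" "sorted s" "r \<noteq> []" "s \<noteq> []"
  shows "hd (sort (r @ s)) = min (hd r) (hd (s :: nat list))"
proof -
  have hd_Min: "hd xs = Min (set xs)" if "sorted xs" "xs \<noteq> []" for xs :: "nat list"
    using that by (cases xs) (auto intro!: Min_eqI[symmetric])
  have "sort (r @ s) \<noteq> []" using assms by (metis append_is_Nil_conv set_empty set_sort)
  then show ?thesis
    using assms by (simp add: hd_Min Min_Un)
qed

lemma head_rows_star_rows:
  "is_ssyt T \<Longrightarrow> is_ssyt U \<Longrightarrow>
   map (\<lambda>r. [hd r]) (star_rows T U) =
   map (\<lambda>r. [hd r]) (star_rows (map (\<lambda>r. [hd r]) T) (map (\<lambda>r. [hd r]) U))"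
proof (induction T U rule: star_rows.induct)
  case (3 r T s U)
  then have "hd (sort (r @ s)) = hd (sort ([hd r] @ [hd s]))"
    by (simp only: hd_sort_append is_ssyt_Cons) (simp add: hd_sort_append min_def)
  with 3 show ?case by (simp add: is_ssyt_Cons)
qed (auto simp: comp_def)

text \<open>
  The head of a sorted row is its minimum, and minima of unions only depend on the minima.
\<close>

lemma head_col_plus: "head_col (T + U) = head_col (head_col T + head_col U)"
  by transfer (rule head_rows_star_rows)

lemma rows_eq_Nil_iff: "rows T = [] \<longleftrightarrow> T = 0"
  by transfer simp

lemma ssyt_plus_eq_0_iff: "T + U = 0 \<longleftrightarrow> T = 0 \<and> U = (0 :: ssyt)"
proof transfer
  show "star_rows T U = [] \<longleftrightarrow> T = [] \<and> U = []" for T U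
    using length_star_rows[of T U] by (auto simp flip: length_0_conv)
qed

lemma head_col_G_cols: "c \<in> G_cols n m \<Longrightarrow> head_col c = c"
  by (metis (no_types, lifting) first_column_def head_col.rep_eq map_map comp_def map_eq_conv rows_G_cols rows_inject)

lemma tail_cols_G_cols: "c \<in> G_cols n m \<Longrightarrow> tail_cols c = 0"
  using ssyt_plus_left_cancel[of c "tail_cols c" 0] head_plus_tail[of c] head_col_G_cols[of c n m] by simp

lemma G_cols_SSYT: "c \<in> G_cols n m \<Longrightarrow> c \<in> SSYT n m"
  by (simp add: G_cols_def)

lemma zero_notin_G_cols: "0 \<notin> G_cols n m"
  by (simp add: G_cols_def rows_eq_Nil_iff)

lemma SSYT_plus_iff: "T + U \<in> SSYT n m \<longleftrightarrow> T \<in> SSYT n m \<and> U \<in> SSYT n m"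
proof -
  have "T \<in> SSYT n m \<longleftrightarrow> length (rows T) \<le> n \<and> (\<Union>r \<in> set (rows T). set r) \<subseteq> {1..m}" for T
    by (auto simp: SSYT_def)
  then show ?thesis
    by (auto simp: plus_ssyt.rep_eq length_star_rows entries_star_rows)
qed

lemma SSYT_head_tail:
  assumes "T \<in> SSYT n m"
  shows "head_col T \<in> SSYT n m" "tail_cols T \<in> SSYT n m"
  using assms SSYT_plus_iff[of "head_col T" "tail_cols T"] by (simp_all add: head_plus_tail)

lemma head_col_in_G_cols: "T \<in> SSYT n m \<Longrightarrow> T \<noteq> 0 \<Longrightarrow> head_col T \<in> G_cols n m"
  using SSYT_head_tail[of T n m] rows_eq_Nil_iff[of T]
  by (simp add: G_cols_def head_col.rep_eq hd_map)

text \<open>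
  Straightening two columns gives again two columns: the first row of their sum has length \<open>2\<close>.
\<close>

lemma tail_cols_two_columns:
  assumes "a \<in> G_cols n m" "c \<in> G_cols n m"
  shows "tail_cols (a + c) \<in> G_cols n m"
proof -
  obtain x xs where a: "rows a = [x] # xs"
    using assms(1) by (cases "rows a") (auto simp: G_cols_def length_Suc_conv)
  obtain y ys where c: "rows c = [y] # ys"
    using assms(2) by (cases "rows c") (auto simp: G_cols_def length_Suc_conv)
  have "length (sort ([x] @ [y])) = 2" by simp
  then obtain z w where "sort ([x] @ [y]) = [z, w]"
    by (auto simp only: length_Suc_conv numeral_2_eq_2 length_0_conv)
  then have "rows (tail_cols (a + c)) \<noteq> []" "length (hd (rows (tail_cols (a + c)))) = 1"
    by (auto simp: tail_cols.rep_eq plus_ssyt.rep_eq a c simp del: sort_key_simps)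
  then show ?thesis
    using assms by (auto simp: G_cols_def intro!: SSYT_head_tail plus_in_SSYT)
qed

text \<open>
  Adding a column only disturbs the first column: the overflow \<open>tail_cols (head_col T + c)\<close> is passed
  on to the remaining columns. Both sides complete the same first column to \<open>T + c\<close>, so
  cancellation gives the claim.
\<close>

lemma tail_cols_plus_column:
  assumes "head_col c = c"
  shows "tail_cols (T + c) = tail_cols (head_col T + c) + tail_cols T"
proof -
  have "head_col (T + c) + tail_cols (T + c) = (head_col T + c) + tail_cols T"
    using head_plus_tail[of T] by (simp add: head_plus_tail ac_simps)
  also have "\<dots> = head_col (T + c) + (tail_cols (head_col T + c) + tail_cols T)"
    using head_plus_tail[of "head_col T + c"] assms
    by (simp add: head_col_plus[of T] add.assoc[symmetric])
  finally show ?thesis by (rule ssyt_plus_left_cancel)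
qed

text \<open>
  The number of columns. The default row \<open>[]\<close> gives width \<open>0\<close> to the empty tableau.
\<close>

definition width :: "ssyt \<Rightarrow> nat" where
  "width T = length (hd (rows T @ [[]]))"

lemma width_tail_cols: "T \<noteq> 0 \<Longrightarrow> width (tail_cols T) < width T"
proof (cases "rows T")
  case (Cons r U)
  then have "r \<noteq> []" using rows[of T] by (auto simp: is_ssyt_Cons)
  with Cons show ?thesis by (auto simp: width_def tail_cols.rep_eq)
qed (simp add: rows_eq_Nil_iff)

lemma SSYT_induct [consumes 1, case_names zero column]:
  assumes "T \<in> SSYT n m" and "P 0"
    and "\<And>a U. a \<in> G_cols n m \<Longrightarrow> U \<in> SSYT n m \<Longrightarrow> P U \<Longrightarrow> P (a + U)"
  shows "P T"
  using assms(1)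
proof (induction "width T" arbitrary: T rule: less_induct)
  case less
  show ?case
  proof (cases "T = 0")
    case False
    then have "P (head_col T + tail_cols T)"
      using less by (intro assms(3) head_col_in_G_cols less.hyps width_tail_cols SSYT_head_tail) auto
    then show ?thesis by (simp add: head_plus_tail)
  qed (use assms(2) in simp)
qed

text \<open>
  The product of the values of \<open>u\<close> over all columns. Recursion through the first column fits the
induction that proves it multiplicative.
\<close>

function weight :: "(ssyt \<Rightarrow> 'k::comm_monoid_mult) \<Rightarrow> ssyt \<Rightarrow> 'k" where
  "weight u T = (if T = 0 then 1 else u (head_col T) * weight u (tail_cols T))"
  by auto
termination
  by (relation "measure (\<lambda>(u, T). width T)") (auto simp: width_tail_cols)

declare weight.simps [simp del]

lemma weight_zero: "weight u 0 = 1"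
  by (simp add: weight.simps)

lemma weight_column: "c \<in> G_cols n m \<Longrightarrow> weight u c = u c"
  using zero_notin_G_cols[of n m]
  by (auto simp: weight.simps[of u c] head_col_G_cols tail_cols_G_cols weight_zero)

text \<open>
  With \<open>a\<close> the first column of \<open>T\<close> and \<open>a + c = p + q\<close> straightened, the first column of \<open>T + c\<close> is \<open>p\<close>
  and the others form \<open>tail_cols T + q\<close>, to which the induction hypothesis applies. The relation
  \<open>u a * u c = u p * u q\<close> is the only one that the step uses.
\<close>

lemma weight_plus_column:
  assumes rel: "\<And>a b c d. a \<in> G_cols n m \<Longrightarrow> b \<in> G_cols n m \<Longrightarrow> c \<in> G_cols n m \<Longrightarrow> d \<in> G_cols n m \<Longrightarrow>
      a + b = c + d \<Longrightarrow> u a * u b = u c * u d"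
    and "T \<in> SSYT n m" "c \<in> G_cols n m"
  shows "weight u (T + c) = weight u T * u c"
  using assms(2,3)
proof (induction "width T" arbitrary: T c rule: less_induct)
  case less
  note T = less.prems(1) and c = less.prems(2)
  show ?case
  proof (cases "T = 0")
    case True
    with c show ?thesis by (simp add: weight_zero weight_column)
  next
    case False
    define a where "a = head_col T"
    define p where "p = head_col (a + c)"
    define q where "q = tail_cols (a + c)"
    have a: "a \<in> G_cols n m" unfolding a_def using T False by (rule head_col_in_G_cols)
    have "a + c \<noteq> 0" using c zero_notin_G_cols[of n m] by (auto simp: ssyt_plus_eq_0_iff)
    then have p: "p \<in> G_cols n m" unfolding p_def
      using a c by (intro head_col_in_G_cols plus_in_SSYT G_cols_SSYT)
    have q: "q \<in> G_cols n m" unfolding q_def using a c by (rule tail_cols_two_columns)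
    have hc: "head_col c = c" using c by (rule head_col_G_cols)
    have "weight u (T + c) = u p * weight u (tail_cols T + q)"
      using False hc
      by (subst weight.simps)
        (simp add: ssyt_plus_eq_0_iff head_col_plus[of T] tail_cols_plus_column p_def q_def a_def add.commute)
    also have "\<dots> = (u p * u q) * weight u (tail_cols T)"
      using less.hyps[OF width_tail_cols[OF False] SSYT_head_tail(2)[OF T] q] by (simp add: ac_simps)
    also have "u p * u q = u a * u c"
      by (rule rel[OF p q a c]) (simp add: p_def q_def head_plus_tail)
    also have "u a * u c * weight u (tail_cols T) = weight u T * u c"
      using False by (simp add: weight.simps[of u T] a_def ac_simps)
    finally show ?thesis .
  qed
qed

lemma weight_plus:
  assumes rel: "\<And>a b c d. a \<in> G_cols n m \<Longrightarrow> b \<in> G_cols n m \<Longrightarrow> c \<in> G_cols n m \<Longrightarrow> d \<in> G_cols n m \<Longrightarrow>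
      a + b = c + d \<Longrightarrow> u a * u b = u c * u d"
    and T: "T \<in> SSYT n m" and U: "U \<in> SSYT n m"
  shows "weight u (T + U) = weight u T * weight u U"
  using U
proof (induction rule: SSYT_induct)
  case (column a U)
  have "weight u (T + (a + U)) = weight u (T + U + a)" by (simp add: ac_simps)
  also have "\<dots> = weight u T * (weight u U * u a)"
    using column T by (simp add: weight_plus_column[OF rel] plus_in_SSYT mult.assoc)
  also have "weight u U * u a = weight u (U + a)"
    using column by (simp add: weight_plus_column[OF rel])
  finally show ?case by (simp add: add.commute)
qed (simp add: weight_zero)

section \<open>Product relations\<close>

lemma finite_G_cols: "finite (G_cols n m)"
proof -
  have "finite {xs. set xs \<subseteq> {1..m} \<and> length xs \<le> n}" by (intro finite_lists_length_le) simp
  then have "finite (first_column ` G_cols n m)"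
    unfolding first_column_G_cols by (rule finite_subset[rotated]) auto
  then show ?thesis using inj_on_first_column finite_imageD by blast
qed

lemma sorted_wrt_less_nth_diff:
  fixes xs :: "nat list"
  assumes "sorted_wrt (<) xs" "j \<le> i" "i < length xs"
  shows "xs ! j + (i - j) \<le> xs ! i"
  using assms(2,3)
proof (induction i rule: dec_induct)
  case (step i)
  then have "xs ! i < xs ! Suc i" using assms(1) by (auto simp: sorted_wrt_iff_nth_less)
  with step show ?case by simp
qed simp

lemma row_mset_G_cols:
  "c \<in> G_cols n m \<Longrightarrow> row_mset (rows c) i =
     (if i < length (first_column c) then {#first_column c ! i#} else {#})"
  by (simp add: row_mset_def rows_G_cols[of c n m])

lemma row_mset_plus: "row_mset (rows (T + U)) i = row_mset (rows T) i + row_mset (rows U) i"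
  by (simp add: plus_ssyt.rep_eq row_mset_star_rows)

text \<open>
  The strictly increasing entries leave no room: the entry in row \<open>j\<close> (counted from 0) is at least
  \<open>j + 1\<close>, and counting back from the last entry it is at most \<open>j + 1\<close>.
\<close>

lemma column_eq_upt:
  assumes "sorted_wrt (<) xs" "set xs \<subseteq> {1..}" "length xs = k" "k \<noteq> 0" "xs ! (k - 1) = k"
  shows "xs = [1..<Suc k]"
proof (rule nth_equalityI)
  fix j assume j: "j < length xs"
  then have "xs ! 0 + j \<le> xs ! j" "xs ! j + (k - 1 - j) \<le> xs ! (k - 1)" 
    using sorted_wrt_less_nth_diff[OF assms(1), of 0 j] sorted_wrt_less_nth_diff[OF assms(1), of j "k - 1"] assms(3)
    by auto
  moreover have "1 \<le> xs ! 0" using assms(2-4) nth_mem[of 0 xs] by fastforce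
  ultimately show "xs ! j = [1..<Suc k] ! j" using j assms(3,5) by (simp del: upt_Suc)
qed (use assms in simp)

text \<open>
  Compare the two sides row by row. If \<open>T1 = [m]\<close>, then the entry \<open>m\<close> of the first row occurs in \<open>T3\<close>
  or \<open>T4\<close>; nothing larger may stand below it, so that column equals \<open>T1\<close>. If \<open>T1 = [1, \<dots>, k]\<close>, then one
  of \<open>T3\<close> and \<open>T4\<close> has the entry \<open>k\<close> in its \<open>k\<close>-th row and hence begins with \<open>1, \<dots>, k\<close>. For \<open>k = n\<close> it
  equals \<open>T1\<close>. For \<open>k = n - 1\<close> and \<open>m = n\<close> it equals \<open>T1\<close> or is the full column \<open>[1, \<dots>, n]\<close>; in the
  latter case the last row shows that \<open>T2\<close> is the full column too.
\<close>

lemma product_relation_avoids_F: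
  assumes T: "{T1, T2, T3, T4} \<subseteq> G_cols n m" and dist: "distinct [T1, T2, T3, T4]"
    and eq: "T1 + T2 = T3 + T4"
  shows "T1 \<notin> F_cols n m"
proof
  assume F: "T1 \<in> F_cols n m"
  define a b c d where abcd: "a = first_column T1" "b = first_column T2" "c = first_column T3" "d = first_column T4"
  have col: "xs \<noteq> [] \<and> length xs \<le> n \<and> sorted_wrt (<) xs \<and> set xs \<subseteq> {1..m}"
    if "xs \<in> {a, b, c, d}" for xs
  proof -
    have "xs \<in> first_column ` G_cols n m" using that T abcd by auto
    then show ?thesis unfolding first_column_G_cols by simp
  qed
  have neq: "a \<noteq> c" "a \<noteq> d" "b \<noteq> c" "b \<noteq> d"
    using T dist inj_on_first_column[of n m] unfolding abcd by (auto dest: inj_onD)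
  \<comment> \<open>The contribution of a column to row i of a sum.\<close>
  define cell where "cell xs i = (if i < length xs then {#xs ! i#} else {#})" for xs :: "nat list" and i
  have cells: "cell a i + cell b i = cell c i + cell d i" for i
  proof -
    have "cell (first_column X) i = row_mset (rows X) i" if "X \<in> G_cols n m" for X
      by (simp add: cell_def row_mset_G_cols[OF that])
    then show ?thesis
      using T arg_cong[OF eq, of "\<lambda>X. row_mset (rows X) i"] by (simp add: abcd row_mset_plus)
  qed
  have upt: "xs = [1..<Suc k]" if "xs \<in> {a, b, c, d}" "length xs = k" "xs ! (k - 1) = k" for xs k
    using col[OF that(1)] that(2,3) by (intro column_eq_upt) auto
  have full: "xs = [1..<Suc n]" if "xs \<in> {a, b, c, d}" "length xs = n" "m = n" for xs
  proof (rule upt)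
    have "xs ! 0 + (n - 1) \<le> xs ! (n - 1)" "1 \<le> xs ! 0" "xs ! (n - 1) \<le> m"
      using col[OF that(1)] that(2) sorted_wrt_less_nth_diff[of xs 0 "n - 1"]
        nth_mem[of 0 xs] nth_mem[of "n - 1" xs] by (auto simp del: nth_mem)
    then show "xs ! (n - 1) = n" using that(3) by linarith
  qed (use that in auto)
  \<comment> \<open>In the following step, x is the column on the right-hand side that begins with 1, ..., k.\<close>
  have prefix: False if F: "a = [1..<Suc k]" "k = n \<or> Suc k = n \<and> m = n" "k \<noteq> 0"
    and x: "{x, y} = {c, d}" and k: "k - 1 < length x" "x ! (k - 1) = k" for k x y
  proof -
    have x': "x \<in> {a, b, c, d}" using x by auto
    have "length x \<noteq> k"
    proof
      assume "length x = k"
      then have "x = a" using upt[OF x' _ k(2)] F(1) by simp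
      then show False using x neq by blast
    qed
    moreover have "k \<le> length x" "length x \<le> n" using col[OF x'] k F(3) by auto
    ultimately have mn: "length x = n" "Suc k = n" "m = n" using F(2) by auto
    have "cell x (n - 1) \<noteq> {#}" using mn by (simp add: cell_def)
    moreover have "cell c (n - 1) + cell d (n - 1) = cell b (n - 1)"
      using cells[of "n - 1"] F(1) mn by (simp add: cell_def del: upt_Suc)
    ultimately have "cell b (n - 1) \<noteq> {#}" using x by (auto simp: doubleton_eq_iff)
    then have "length b = n" using col[of b] mn by (auto simp: cell_def split: if_splits)
    then have "b = x" using full[of b] full[OF x'] mn by simp
    then show False using x neq by blast
  qed
  have F': "a = [m] \<or> (\<exists>k. a = [1..<Suc k] \<and> (k = n \<or> Suc k = n \<and> m = n) \<and> k \<noteq> 0)"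
  proof -
    have "a \<noteq> []" using col[of a] by simp
    moreover have "a = [m] \<or> a = [1..<Suc n] \<or> a = [1..<n] \<and> m = n"
      using F by (auto simp: F_cols_def abcd split: if_splits)
    ultimately show ?thesis by (cases n) (fastforce simp del: upt_Suc)+
  qed
  then show False
  proof
    assume a: "a = [m]"
    have single: "x = [m]" if "x \<in> {c, d}" "hd x = m" for x
    proof (cases x)
      case (Cons y ys)
      then have "ys = []" using col[of x] that by (cases ys) auto
      with Cons that show ?thesis by simp
    qed (use col[of x] that in auto)
    have "m \<in># cell c 0 + cell d 0" unfolding cells[symmetric] by (simp add: a cell_def)
    then have "hd c = m \<or> hd d = m"
      by (auto simp: cell_def hd_conv_nth split: if_splits)
    then show False using single[of c] single[of d] a neq by auto
  next
    assume "\<exists>k. a = [1..<Suc k] \<and> (k = n \<or> Suc k = n \<and> m = n) \<and> k \<noteq> 0"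
    then obtain k where k: "a = [1..<Suc k]" "k = n \<or> Suc k = n \<and> m = n" "k \<noteq> 0" by blast
    have "k \<in># cell c (k - 1) + cell d (k - 1)"
      unfolding cells[symmetric] using k by (simp add: cell_def del: upt_Suc)
    then have "k - 1 < length c \<and> c ! (k - 1) = k \<or> k - 1 < length d \<and> d ! (k - 1) = k"
      by (auto simp: cell_def split: if_splits)
    then show False using prefix[OF k, of c d] prefix[OF k, of d c] by auto
  qed
qed

lemma product_relation_in_E:
  assumes T: "{T1, T2, T3, T4} \<subseteq> G_cols n m" and dist: "distinct [T1, T2, T3, T4]"
    and eq: "T1 + T2 = T3 + T4"
  shows "{T1, T2, T3, T4} \<subseteq> E_cols n m"
  using product_relation_avoids_F[of T1 T2 T3 T4 n m] product_relation_avoids_F[of T2 T1 T3 T4 n m]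
    product_relation_avoids_F[of T3 T4 T1 T2 n m] product_relation_avoids_F[of T4 T3 T1 T2 n m]
    assms by (auto simp: E_cols_def add.commute)

lemma double_column_eq:
  assumes a: "a \<in> G_cols n m" and c: "c \<in> G_cols n m" and d: "d \<in> G_cols n m"
    and eq: "a + a = c + d"
  shows "c = a"
proof -
  have "row_mset (rows c) i = row_mset (rows a) i" for i
    using arg_cong[OF eq, of "\<lambda>X. row_mset (rows X) i"]
    by (auto simp: row_mset_plus row_mset_G_cols[OF a] row_mset_G_cols[OF c] row_mset_G_cols[OF d]
        add_eq_conv_ex split: if_splits)
  then have "rows c = rows a"
    using rows[of a] rows[of c] by (intro rows_determined_by_row_msets) auto
  then show ?thesis by (simp add: rows_inject)
qed

text \<open>
  A coincidence between the two sides can be cancelled, and a square \<open>a + a\<close> is straightened in only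
  one way. So relations with a repeated column hold trivially.
\<close>

lemma product_relations_suffice:
  fixes u :: "ssyt \<Rightarrow> 'k::comm_monoid_mult"
  assumes rel: "\<And>a b c d. {a, b, c, d} \<subseteq> G_cols n m \<Longrightarrow> distinct [a, b, c, d] \<Longrightarrow>
      a + b = c + d \<Longrightarrow> u a * u b = u c * u d"
    and G: "a \<in> G_cols n m" "b \<in> G_cols n m" "c \<in> G_cols n m" "d \<in> G_cols n m"
    and eq: "a + b = c + d"
  shows "u a * u b = u c * u d"
proof -
  have cancel: "y = w" if "x + y = x + w" for x y w :: ssyt
    using that by (rule ssyt_plus_left_cancel)
  consider "a = b" | "c = d" | "a = c" | "a = d" | "b = c" | "b = d" | "distinct [a, b, c, d]"
    by auto
  then show ?thesis
  proof cases
    case 1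
    then have "c = a" "d = a"
      using double_column_eq[OF G(1,3,4)] double_column_eq[OF G(1,4,3)] eq by (auto simp: add.commute)
    then show ?thesis using 1 by simp
  next
    case 2
    then have "a = c" "b = c"
      using double_column_eq[OF G(3,1,2)] double_column_eq[OF G(3,2,1)] eq by (auto simp: add.commute)
    then show ?thesis using 2 by simp
  next
    case 3
    then show ?thesis using cancel[of a b d] eq by simp
  next
    case 4
    then show ?thesis using cancel[of a b c] eq by (simp add: ac_simps)
  next
    case 5
    then show ?thesis using cancel[of b a d] eq by (simp add: ac_simps)
  next
    case 6
    then show ?thesis using cancel[of b a c] eq by (simp add: ac_simps)
  next
    case 7
    then show ?thesis using rel[of a b c d] G eq by simp
  qed
qed

section \<open>Points and ideals of a monoid algebra\<close>

text \<open>
  A map from a monoid to \<open>K\<close> extends linearly to the monoid algebra. This covers both the evaluation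
  of polynomials, by extending the evaluation of monomials, and the points of the tableaux algebra.
\<close>

definition linear_extension :: "('a \<Rightarrow> 'k) \<Rightarrow> ('a \<Rightarrow>\<^sub>0 'k::comm_ring_1) \<Rightarrow> 'k" where
  "linear_extension \<chi> f = (\<Sum>k \<in> Poly_Mapping.keys f. Poly_Mapping.lookup f k * \<chi> k)"

lemma linear_extension_superset:
  assumes "finite K" "Poly_Mapping.keys f \<subseteq> K"
  shows "linear_extension \<chi> f = (\<Sum>k \<in> K. Poly_Mapping.lookup f k * \<chi> k)"
  unfolding linear_extension_def
  using assms by (intro sum.mono_neutral_left) (auto simp: in_keys_iff)

lemma linear_extension_single: "linear_extension \<chi> (Poly_Mapping.single k c) = c * \<chi> k"
  by (subst linear_extension_superset[of "{k}"]) auto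

lemma linear_extension_diff:
  "linear_extension \<chi> (f - g) = linear_extension \<chi> f - linear_extension \<chi> g"
proof -
  let ?K = "Poly_Mapping.keys f \<union> Poly_Mapping.keys g"
  have "Poly_Mapping.keys (f - g) \<subseteq> ?K" by (rule keys_diff)
  then show ?thesis
    by (subst (1 2 3) linear_extension_superset[of ?K])
      (auto simp: lookup_minus left_diff_distrib sum_subtractf)
qed

lemma linear_extension_add:
  "linear_extension \<chi> (f + g) = linear_extension \<chi> f + linear_extension \<chi> g"
  using linear_extension_diff[of \<chi> "f + g" g] by simp

lemma linear_extension_sum: "linear_extension \<chi> (sum F I) = (\<Sum>i\<in>I. linear_extension \<chi> (F i))"
  by (induction I rule: infinite_finite_induct)
    (simp_all add: linear_extension_add, simp_all add: linear_extension_def)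

lemma poly_mapping_expand:
  "f = (\<Sum>k \<in> Poly_Mapping.keys f. Poly_Mapping.single k (Poly_Mapping.lookup f k))"
proof (rule poly_mapping_eqI)
  fix k
  show "Poly_Mapping.lookup f k =
    Poly_Mapping.lookup (\<Sum>k \<in> Poly_Mapping.keys f. Poly_Mapping.single k (Poly_Mapping.lookup f k)) k"
    by (cases "k \<in> Poly_Mapping.keys f")
      (auto simp: lookup_sum lookup_single when_def in_keys_iff)
qed

lemma linear_extension_mult:
  assumes \<chi>: "\<And>a b. a \<in> Poly_Mapping.keys f \<Longrightarrow> b \<in> Poly_Mapping.keys g \<Longrightarrow> \<chi> (a + b) = \<chi> a * \<chi> b"
  shows "linear_extension \<chi> (f * g) = linear_extension \<chi> f * linear_extension \<chi> g"
proof -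
  have "f * g = (\<Sum>k \<in> Poly_Mapping.keys f. Poly_Mapping.single k (Poly_Mapping.lookup f k)) *
      (\<Sum>l \<in> Poly_Mapping.keys g. Poly_Mapping.single l (Poly_Mapping.lookup g l))"
    by (simp only: poly_mapping_expand[symmetric])
  also have "\<dots> = (\<Sum>k \<in> Poly_Mapping.keys f. \<Sum>l \<in> Poly_Mapping.keys g.
      Poly_Mapping.single (k + l) (Poly_Mapping.lookup f k * Poly_Mapping.lookup g l))"
    by (simp add: sum_product mult_single)
  finally have "linear_extension \<chi> (f * g) = (\<Sum>k \<in> Poly_Mapping.keys f. \<Sum>l \<in> Poly_Mapping.keys g.
      (Poly_Mapping.lookup f k * Poly_Mapping.lookup g l) * \<chi> (k + l))"
    by (simp add: linear_extension_sum linear_extension_single)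
  also have "\<dots> = linear_extension \<chi> f * linear_extension \<chi> g"
    by (auto simp: linear_extension_def sum_product \<chi> ac_simps intro!: sum.cong)
  finally show ?thesis .
qed

text \<open>
  Monoid algebras of submonoids are used for the tableaux algebra and for the polynomial rings alike.
\<close>

locale additive_submonoid =
  fixes A :: "'a::comm_monoid_add set"
  assumes zero_in: "0 \<in> A" and plus_in: "a \<in> A \<Longrightarrow> b \<in> A \<Longrightarrow> a + b \<in> A"
begin

definition elements :: "('a \<Rightarrow>\<^sub>0 'k::comm_ring_1) set" where
  "elements = {f. Poly_Mapping.keys f \<subseteq> A}"

lemma monoid_algebra_simps:
  "carrier (monoid_algebra A) = elements"
  "mult (monoid_algebra A) = (*)" "one (monoid_algebra A) = 1"
  "zero (monoid_algebra A) = 0" "add (monoid_algebra A) = (+)"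
  by (simp_all add: monoid_algebra_def elements_def)

lemma cring: "cring (monoid_algebra A)"
  by (intro cring_monoid_algebra zero_in plus_in)

lemma single_in_elements: "a \<in> A \<Longrightarrow> Poly_Mapping.single a c \<in> elements"
  by (simp add: elements_def)

lemma unital_subring_elements: "unital_subring (elements :: ('a \<Rightarrow>\<^sub>0 'k::comm_ring_1) set)"
proof -
  interpret R: cring "monoid_algebra A :: ('a \<Rightarrow>\<^sub>0 'k) ring" by (rule cring)
  have "f - g \<in> elements" if "f \<in> elements" "g \<in> elements" for f g :: "'a \<Rightarrow>\<^sub>0 'k"
    using that keys_diff[of f g] by (auto simp: elements_def)
  moreover have "f * g \<in> elements" if "f \<in> elements" "g \<in> elements" for f g :: "'a \<Rightarrow>\<^sub>0 'k"
    using R.m_closed[of f g] that by (simp add: monoid_algebra_simps)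
  moreover have "1 \<in> (elements :: ('a \<Rightarrow>\<^sub>0 'k) set)"
    using R.one_closed by (simp add: monoid_algebra_simps)
  ultimately show ?thesis by (simp add: unital_subring_def)
qed

text \<open>
  Negatives come for free, as multiples by \<open>-1\<close>.
\<close>

lemma ideal_iff:
  fixes I :: "('a \<Rightarrow>\<^sub>0 'k::comm_ring_1) set"
  shows "ideal I (monoid_algebra A) \<longleftrightarrow>
    I \<subseteq> elements \<and> 0 \<in> I \<and> (\<forall>f \<in> I. \<forall>g \<in> I. f + g \<in> I) \<and> (\<forall>r \<in> elements. \<forall>f \<in> I. r * f \<in> I)"
    (is "_ \<longleftrightarrow> ?R")
proof
  interpret R: cring "monoid_algebra A :: ('a \<Rightarrow>\<^sub>0 'k) ring" by (rule cring)
  assume "ideal I (monoid_algebra A)"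
  then interpret I: ideal I "monoid_algebra A" .
  show ?R
    using I.a_subset I.a_closed I.zero_closed I.I_l_closed
    by (auto simp: monoid_algebra_simps)
next
  interpret R: cring "monoid_algebra A :: ('a \<Rightarrow>\<^sub>0 'k) ring" by (rule cring)
  note E = unital_subring_elements
  assume I: ?R
  have neg: "- f \<in> I" if "f \<in> I" for f
    using I that subring_diff[OF E subring_zero[OF E] subring_one[OF E]] by force
  have minus: "\<ominus>\<^bsub>monoid_algebra A\<^esub> f = - f" if "f \<in> I" for f
    using I that neg[OF that] by (intro R.minus_equality) (auto simp: monoid_algebra_simps)
  show "ideal I (monoid_algebra A)"
  proof (rule idealI)
    show "subgroup I (add_monoid (monoid_algebra A))"
    proof (rule subgroup.intro)
      fix f assume f: "f \<in> I"
      show "inv\<^bsub>add_monoid (monoid_algebra A)\<^esub> f \<in> I"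
        using minus[OF f] neg[OF f] by (simp add: a_inv_def)
    qed (use I in \<open>auto simp: monoid_algebra_simps\<close>)
    show "ring (monoid_algebra A :: ('a \<Rightarrow>\<^sub>0 'k) ring)" by (rule R.ring_axioms)
    show "x \<otimes>\<^bsub>monoid_algebra A\<^esub> f \<in> I" "f \<otimes>\<^bsub>monoid_algebra A\<^esub> x \<in> I"
      if "f \<in> I" "x \<in> carrier (monoid_algebra A)" for f x
      using I that by (auto simp: monoid_algebra_simps mult.commute[of f])
  qed
qed

lemma kernel_ideal:
  assumes "ring_hom_on elements \<phi>"
  shows "ideal {f \<in> elements. \<phi> f = 0} (monoid_algebra A)"
  using assms
  by (auto simp: ideal_iff ring_hom_on_zero[OF unital_subring_elements]
      ring_hom_on_add[OF unital_subring_elements] ring_hom_on_mult[OF unital_subring_elements]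
      intro: subring_zero subring_add subring_mult unital_subring_elements)

text \<open>
  An element outside the kernel is, up to a constant factor, congruent to \<open>1\<close> modulo the kernel.
\<close>

lemma kernel_maximal:
  fixes \<phi> :: "('a \<Rightarrow>\<^sub>0 'k::field) \<Rightarrow> 'k"
  assumes \<phi>: "ring_hom_on elements \<phi>" and const: "\<And>c. \<phi> (Poly_Mapping.single 0 c) = c"
  shows "maximalideal {f \<in> elements. \<phi> f = 0} (monoid_algebra A)" (is "maximalideal ?K _")
proof (rule maximalidealI)
  note E = unital_subring_elements
  show "ideal ?K (monoid_algebra A)" using \<phi> by (rule kernel_ideal)
  show "carrier (monoid_algebra A) \<noteq> ?K"
  proof
    assume "carrier (monoid_algebra A) = ?K"
    then have "\<phi> 1 = 0" using subring_one[OF E] unfolding monoid_algebra_simps by blast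
    then show False using ring_hom_on_one[OF E \<phi>] by simp
  qed
  fix J assume J: "ideal J (monoid_algebra A)" "?K \<subseteq> J" "J \<subseteq> carrier (monoid_algebra A)"
  show "J = ?K \<or> J = carrier (monoid_algebra A)"
  proof (cases "J = ?K")
    case False
    then obtain f where f: "f \<in> J" "f \<in> elements" "\<phi> f \<noteq> 0"
      using J by (auto simp: monoid_algebra_simps)
    define c where "c = Poly_Mapping.single (0 :: 'a) (inverse (\<phi> f))"
    have c: "c \<in> elements" unfolding c_def by (intro single_in_elements zero_in)
    have cf: "c * f \<in> elements" using c f(2) by (rule subring_mult[OF E])
    have "1 - c * f \<in> ?K"
      using f c cf const[of "inverse (\<phi> f)"]
      by (simp add: subring_diff[OF E] subring_one[OF E] ring_hom_on_diff[OF E \<phi>]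
          ring_hom_on_mult[OF E \<phi>] ring_hom_on_one[OF E \<phi>] c_def)
    moreover have "c * f \<in> J" using J(1) c f(1) by (simp add: ideal_iff)
    ultimately have "1 - c * f + c * f \<in> J" using J unfolding ideal_iff by blast
    then have "1 \<in> J" by simp
    then have "r \<in> J" if "r \<in> elements" for r
      using J(1) that unfolding ideal_iff by (metis mult.right_neutral)
    then show ?thesis using J(3) by (auto simp: monoid_algebra_simps)
  qed simp
qed

lemma linear_extension_hom:
  assumes "\<chi> 0 = 1" "\<And>a b. a \<in> A \<Longrightarrow> b \<in> A \<Longrightarrow> \<chi> (a + b) = \<chi> a * \<chi> b"
  shows "ring_hom_on elements (linear_extension \<chi>)"
proof -
  have "linear_extension \<chi> 1 = 1"
    using linear_extension_single[of \<chi> 0 1] assms(1) by simp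
  then show ?thesis
    using assms(2)
    by (auto simp: ring_hom_on_def elements_def linear_extension_diff subset_iff
        intro!: linear_extension_mult)
qed

lemma hom_eq_linear_extension:
  fixes \<phi> :: "('a \<Rightarrow>\<^sub>0 'k::comm_ring_1) \<Rightarrow> 'k"
  assumes \<phi>: "ring_hom_on elements \<phi>" and const: "\<And>c. \<phi> (Poly_Mapping.single 0 c) = c"
    and f: "f \<in> elements"
  shows "\<phi> f = linear_extension (\<lambda>a. \<phi> (Poly_Mapping.single a 1)) f"
proof -
  note E = unital_subring_elements
  have A: "k \<in> A" if "k \<in> Poly_Mapping.keys f" for k using f that by (auto simp: elements_def)
  have scale: "\<phi> (Poly_Mapping.single k c) = c * \<phi> (Poly_Mapping.single k 1)" if "k \<in> A" for k c
    using ring_hom_on_mult[OF E \<phi> single_in_elements[OF zero_in, of c] single_in_elements[OF that, of 1]]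
    by (simp add: mult_single const)
  have "\<phi> f = \<phi> (\<Sum>k \<in> Poly_Mapping.keys f. Poly_Mapping.single k (Poly_Mapping.lookup f k))"
    by (simp only: poly_mapping_expand[symmetric])
  also have "\<dots> = (\<Sum>k \<in> Poly_Mapping.keys f. \<phi> (Poly_Mapping.single k (Poly_Mapping.lookup f k)))"
    by (intro ring_hom_on_sum[OF E \<phi>] single_in_elements A)
  also have "\<dots> = linear_extension (\<lambda>a. \<phi> (Poly_Mapping.single a 1)) f"
    unfolding linear_extension_def by (intro sum.cong refl scale A)
  finally show ?thesis .
qed

end

lemma monomial_value_plus:
  fixes x :: "'v \<Rightarrow> 'k::comm_ring_1"
  defines "val \<alpha> \<equiv> \<Prod>v \<in> Poly_Mapping.keys \<alpha>. x v ^ Poly_Mapping.lookup \<alpha> v"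
  shows "val (\<alpha> + \<beta>) = val \<alpha> * val \<beta>"
proof -
  let ?K = "Poly_Mapping.keys \<alpha> \<union> Poly_Mapping.keys \<beta>"
  have val: "val \<gamma> = (\<Prod>v \<in> ?K. x v ^ Poly_Mapping.lookup \<gamma> v)" if "Poly_Mapping.keys \<gamma> \<subseteq> ?K" for \<gamma>
    unfolding val_def using that by (intro prod.mono_neutral_left) (auto simp: in_keys_iff)
  show ?thesis
    using keys_add[of \<alpha> \<beta>] by (simp add: val lookup_add power_add prod.distrib)
qed

lemma poly_value_conv_linear_extension:
  "poly_value x = linear_extension (\<lambda>\<alpha>. \<Prod>v \<in> Poly_Mapping.keys \<alpha>. x v ^ Poly_Mapping.lookup \<alpha> v)"
  by (simp add: poly_value_def linear_extension_def fun_eq_iff)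

lemma poly_value_mult: "poly_value x (p * q) = poly_value x p * poly_value x q"
  unfolding poly_value_conv_linear_extension by (intro linear_extension_mult monomial_value_plus)

lemma poly_value_diff: "poly_value x (p - q) = poly_value x p - poly_value x q"
  unfolding poly_value_conv_linear_extension by (rule linear_extension_diff)

lemma poly_value_pvar: "poly_value x (pvar v) = x v"
  unfolding poly_value_conv_linear_extension pvar_def by (simp add: linear_extension_single)

lemma poly_value_one: "poly_value x 1 = 1"
  unfolding poly_value_conv_linear_extension by (simp add: linear_extension_single flip: single_one)

section \<open>The maximal ideals of the tableaux algebra\<close>

interpretation SSYT: additive_submonoid "SSYT n m" for n m
  by standard (simp_all add: zero_in_SSYT plus_in_SSYT)

interpretation monomials: additive_submonoid "{\<alpha> :: 'v \<Rightarrow>\<^sub>0 nat. Poly_Mapping.keys \<alpha> \<subseteq> Y}" for Y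
  by standard (use keys_add in force)+

lemma tableaux_algebra_simps:
  "carrier (tableaux_algebra n m) = SSYT.elements n m"
  "mult (tableaux_algebra n m) = (*)" "one (tableaux_algebra n m) = 1"
  "zero (tableaux_algebra n m) = 0" "add (tableaux_algebra n m) = (+)"
  by (simp_all add: tableaux_algebra_def SSYT.monoid_algebra_simps)

lemma F_cols_subset: "F_cols n m \<subseteq> G_cols n m"
  by (auto simp: F_cols_def)

lemma G_cols_eq: "G_cols n m = E_cols n m \<union> F_cols n m"
  using F_cols_subset by (auto simp: E_cols_def)

text \<open>
  The generators lie in the kernel. Conversely, modulo the ideal every column is congruent to its
  value, hence so is every tableau, by induction on its columns, and every element \<open>f\<close>, by linearity.
  If \<open>\<phi> f = 0\<close>, then \<open>f\<close> is congruent to \<open>0\<close>.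
\<close>

lemma M_ideal_eq_kernel:
  fixes \<phi> :: "(ssyt \<Rightarrow>\<^sub>0 'k::field) \<Rightarrow> 'k"
  assumes \<phi>: "ring_hom_on (SSYT.elements n m) \<phi>" and const: "\<And>c. \<phi> (Poly_Mapping.single 0 c) = c"
    and t: "\<And>T. T \<in> E_cols n m \<Longrightarrow> t T = \<phi> (Poly_Mapping.single T 1)"
    and t': "\<And>T. T \<in> F_cols n m \<Longrightarrow> t' T = \<phi> (Poly_Mapping.single T 1)"
  shows "M_ideal n m t t' = {f \<in> SSYT.elements n m. \<phi> f = 0}" (is "?M = ?K")
proof -
  note E = SSYT.unital_subring_elements[of n m]
  interpret R: cring "tableaux_algebra n m :: (ssyt \<Rightarrow>\<^sub>0 'k) ring" by (rule cring_tableaux_algebra)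
  define gens where "gens = (\<lambda>T. Poly_Mapping.single T 1 - Poly_Mapping.single 0 (\<phi> (Poly_Mapping.single T 1))) ` G_cols n m"
  have M: "?M = Idl\<^bsub>tableaux_algebra n m\<^esub> gens"
    unfolding M_ideal_def gens_def G_cols_eq image_Un
    by (simp add: setcompr_eq_image t t' cong: image_cong)
  have single: "Poly_Mapping.single T c \<in> SSYT.elements n m" if "T \<in> SSYT n m" for T and c :: 'k
    using that by (rule SSYT.single_in_elements)
  have gK: "gens \<subseteq> ?K"
    by (auto simp: gens_def const ring_hom_on_diff[OF E \<phi>] single G_cols_SSYT zero_in_SSYT
        intro!: subring_diff[OF E])
  have carr: "gens \<subseteq> carrier (tableaux_algebra n m)"
    using gK by (auto simp: tableaux_algebra_def SSYT.monoid_algebra_simps)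
  have "ideal ?K (tableaux_algebra n m)"
    unfolding tableaux_algebra_def using \<phi> by (rule SSYT.kernel_ideal)
  then have sub: "?M \<subseteq> ?K" unfolding M using gK by (rule R.genideal_minimal)
  have "ideal ?M (tableaux_algebra n m)" unfolding M using carr by (rule R.genideal_ideal)
  then have M0: "0 \<in> ?M" and Madd: "\<And>f g. f \<in> ?M \<Longrightarrow> g \<in> ?M \<Longrightarrow> f + g \<in> ?M"
    and Mmult: "\<And>r f. r \<in> SSYT.elements n m \<Longrightarrow> f \<in> ?M \<Longrightarrow> r * f \<in> ?M"
    unfolding tableaux_algebra_def SSYT.ideal_iff by blast+
  have gM: "gens \<subseteq> ?M" unfolding M using carr by (rule R.genideal_self)
  have tab: "Poly_Mapping.single T 1 - Poly_Mapping.single 0 (\<phi> (Poly_Mapping.single T 1)) \<in> ?M"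
    if "T \<in> SSYT n m" for T
    using that
  proof (induction rule: SSYT_induct)
    case zero
    then show ?case using M0 ring_hom_on_one[OF E \<phi>] by simp
  next
    case (column a U)
    define ca cU where "ca = \<phi> (Poly_Mapping.single a 1)" "cU = \<phi> (Poly_Mapping.single U 1)"
    have a: "a \<in> SSYT n m" using column by (simp add: G_cols_SSYT)
    have prod: "Poly_Mapping.single (a + U) 1 = Poly_Mapping.single a 1 * Poly_Mapping.single U (1 :: 'k)"
      by (simp add: mult_single)
    have "\<phi> (Poly_Mapping.single (a + U) 1) = ca * cU"
      unfolding prod ca_cU_def using a column by (intro ring_hom_on_mult[OF E \<phi>] single)
    then have "Poly_Mapping.single (a + U) 1 - Poly_Mapping.single 0 (\<phi> (Poly_Mapping.single (a + U) 1)) =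
       Poly_Mapping.single U 1 * (Poly_Mapping.single a 1 - Poly_Mapping.single 0 ca) +
       Poly_Mapping.single 0 ca * (Poly_Mapping.single U 1 - Poly_Mapping.single 0 cU)"
      by (simp add: prod right_diff_distrib mult.commute) (simp add: mult_single)
    also have "\<dots> \<in> ?M"
      using column gM by (intro Madd Mmult single zero_in_SSYT) (auto simp: ca_cU_def gens_def)
    finally show ?case .
  qed
  have "f \<in> ?M" if f: "f \<in> ?K" for f
  proof -
    define \<chi> where "\<chi> T = \<phi> (Poly_Mapping.single T 1)" for T
    have "linear_extension \<chi> f = 0"
      using f SSYT.hom_eq_linear_extension[OF \<phi> const, of f] unfolding \<chi>_def by simp
    then have "f = (\<Sum>T \<in> Poly_Mapping.keys f. Poly_Mapping.single T (Poly_Mapping.lookup f T)) -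
        Poly_Mapping.single 0 (linear_extension \<chi> f)"
      by (simp flip: poly_mapping_expand)
    also have "\<dots> = (\<Sum>T \<in> Poly_Mapping.keys f. Poly_Mapping.single 0 (Poly_Mapping.lookup f T) *
        (Poly_Mapping.single T 1 - Poly_Mapping.single 0 (\<chi> T)))"
    proof -
      have "Poly_Mapping.single 0 (linear_extension \<chi> f) =
        (\<Sum>T \<in> Poly_Mapping.keys f. Poly_Mapping.single (0 :: ssyt) (Poly_Mapping.lookup f T * \<chi> T))"
        unfolding linear_extension_def by (induction rule: infinite_finite_induct) (auto simp: single_add)
      then show ?thesis
        by (simp add: right_diff_distrib mult_single sum_subtractf)
    qed
    also have "\<dots> \<in> ?M"
    proof -
      have sum: "sum F I \<in> ?M" if "\<And>i. i \<in> I \<Longrightarrow> F i \<in> ?M" for F and I :: "ssyt set"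
        using that by (induction I rule: infinite_finite_induct) (auto intro: M0 Madd)
      show ?thesis
        using f unfolding \<chi>_def
        by (intro sum Mmult tab single zero_in_SSYT) (auto simp: SSYT.elements_def)
    qed
    finally show ?thesis .
  qed
  with sub show ?thesis by blast
qed

text \<open>
  The columns generate the tableaux algebra over the constants, and there are finitely many of them.
  This is the finiteness that the Nullstellensatz asks for.
\<close>

lemma tableaux_algebra_generated:
  assumes "set Ts = G_cols n m"
  shows "SSYT.elements n m =
    adjoins (range (Poly_Mapping.single 0)) (map (\<lambda>T. Poly_Mapping.single T (1 :: 'k::field)) Ts)" (is "_ = ?A")
proof
  note E = SSYT.unital_subring_elements[of n m]
  let ?c = "Poly_Mapping.single 0 :: 'k \<Rightarrow> (ssyt \<Rightarrow>\<^sub>0 'k)"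
  have R: "unital_subring (range ?c)"
    by (auto simp: unital_subring_def mult_single simp flip: single_one single_diff)
  have A: "unital_subring ?A" using R by (rule unital_subring_adjoins)
  have const: "?c c \<in> ?A" for c using subset_adjoins[OF R] by blast
  have tab: "Poly_Mapping.single T 1 \<in> ?A" if "T \<in> SSYT n m" for T
    using that
  proof (induction rule: SSYT_induct)
    case zero
    then show ?case using subring_one[OF A] by simp
  next
    case (column a U)
    have "Poly_Mapping.single a 1 \<in> ?A"
      using generators_in_adjoins[OF R, of "map (\<lambda>T. Poly_Mapping.single T 1) Ts"] column assms by auto
    from subring_mult[OF A this column(3)] show ?case by (simp add: mult_single)
  qed
  show "SSYT.elements n m \<subseteq> ?A"
  proof
    fix f :: "ssyt \<Rightarrow>\<^sub>0 'k" assume f: "f \<in> SSYT.elements n m"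
    have "Poly_Mapping.single T c \<in> ?A" if "T \<in> SSYT n m" for T c
      using subring_mult[OF A const[of c] tab[OF that]] by (simp add: mult_single)
    then show "f \<in> ?A"
      using f by (subst poly_mapping_expand) (auto intro!: subring_sum[OF A] simp: SSYT.elements_def)
  qed
  have sub: "adjoins B xs \<subseteq> SSYT.elements n m"
    if "B \<subseteq> SSYT.elements n m" "set xs \<subseteq> SSYT.elements n m" for B and xs :: "(ssyt \<Rightarrow>\<^sub>0 'k) list"
    using that
  proof (induction xs arbitrary: B)
    case (Cons x xs)
    then have "adjoin B x \<subseteq> SSYT.elements n m" by (intro adjoin_subset[OF E]) auto
    with Cons show ?case by simp
  qed simp
  show "?A \<subseteq> SSYT.elements n m"
    by (rule sub) (auto simp: assms intro!: SSYT.single_in_elements zero_in_SSYT G_cols_SSYT)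
qed

text \<open>
  The Nullstellensatz gives a point that kills \<open>M\<close>; its kernel is a proper ideal containing \<open>M\<close>.
\<close>

lemma maximalideal_has_point:
  fixes M :: "(ssyt \<Rightarrow>\<^sub>0 'k::alg_closed_field) set"
  assumes M: "maximalideal M (tableaux_algebra n m)"
  obtains \<phi> :: "(ssyt \<Rightarrow>\<^sub>0 'k) \<Rightarrow> 'k" where "ring_hom_on (SSYT.elements n m) \<phi>"
    "\<forall>c. \<phi> (Poly_Mapping.single 0 c) = c" "M = {f \<in> SSYT.elements n m. \<phi> f = 0}"
proof -
  interpret R: cring "tableaux_algebra n m :: (ssyt \<Rightarrow>\<^sub>0 'k) ring" by (rule cring_tableaux_algebra)
  interpret P: primeideal M "tableaux_algebra n m" using M by (rule R.maximalideal_prime)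
  note simps = tableaux_algebra_simps
  have id: "M \<subseteq> SSYT.elements n m" "0 \<in> M" "\<And>f g. f \<in> M \<Longrightarrow> g \<in> M \<Longrightarrow> f + g \<in> M"
    "\<And>r f. r \<in> SSYT.elements n m \<Longrightarrow> f \<in> M \<Longrightarrow> r * f \<in> M"
    using P.is_ideal unfolding tableaux_algebra_def SSYT.ideal_iff by blast+
  have one: "1 \<notin> M"
    using P.I_notcarr P.one_imp_carrier by (auto simp: simps)
  interpret prime_of_subring "SSYT.elements n m" M
    by standard (use id one P.I_prime in \<open>auto simp: simps SSYT.unital_subring_elements\<close>)
  obtain Ts where Ts: "set Ts = G_cols n m" using finite_list[OF finite_G_cols] by blast
  have "ring_hom_on UNIV (Poly_Mapping.single 0 :: 'k \<Rightarrow> (ssyt \<Rightarrow>\<^sub>0 'k))"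
    by (simp add: ring_hom_on_def single_diff mult_single)
  from nullstellensatz[OF this _ _ tableaux_algebra_generated[OF Ts]]
  obtain \<phi> :: "(ssyt \<Rightarrow>\<^sub>0 'k) \<Rightarrow> 'k" where \<phi>: "ring_hom_on (SSYT.elements n m) \<phi>" "\<forall>s \<in> M. \<phi> s = 0"
    and const: "\<forall>c. \<phi> (Poly_Mapping.single 0 c) = c"
    using Ts by (auto intro!: SSYT.single_in_elements zero_in_SSYT G_cols_SSYT)
  let ?K = "{f \<in> SSYT.elements n m. \<phi> f = 0}"
  have K: "maximalideal ?K (tableaux_algebra n m)"
    unfolding tableaux_algebra_def using \<phi>(1) const by (intro SSYT.kernel_maximal) auto
  then interpret K: maximalideal ?K "tableaux_algebra n m" .
  interpret M: maximalideal M "tableaux_algebra n m" by (rule M)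
  have "?K = M"
    using M.I_maximal[OF K.is_ideal] \<phi>(2) id(1) K.I_notcarr by (auto simp: simps)
  then show ?thesis using that \<phi> const by blast
qed

text \<open>
  The polynomials over \<open>E_cols n m\<close> that vanish at the tuple form an ideal of the polynomial ring. It
  contains the product relations since these are polynomials in the variables \<open>E_cols n m\<close> and \<open>\<phi>\<close> is
  multiplicative.
\<close>

lemma point_in_zero_locus:
  fixes \<phi> :: "(ssyt \<Rightarrow>\<^sub>0 'k::field) \<Rightarrow> 'k"
  assumes \<phi>: "ring_hom_on (SSYT.elements n m) \<phi>"
  shows "restrict (\<lambda>T. \<phi> (Poly_Mapping.single T 1)) (E_cols n m) \<in> zero_locus (E_cols n m) (P_ideal n m)"
proof -
  define t where "t = restrict (\<lambda>T. \<phi> (Poly_Mapping.single T 1)) (E_cols n m)"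
  let ?Y = "E_cols n m"
  let ?K = "{p \<in> monomials.elements ?Y. poly_value t p = 0}"
  interpret R: cring "poly_ring ?Y :: ((ssyt \<Rightarrow>\<^sub>0 nat) \<Rightarrow>\<^sub>0 'k) ring" by (rule cring_poly_ring)
  note S = monomials.unital_subring_elements[of ?Y]
  have "ideal ?K (poly_ring ?Y)"
    unfolding poly_ring_def
    by (rule monomials.kernel_ideal) (simp add: ring_hom_on_def poly_value_diff poly_value_mult poly_value_one)
  moreover have "product_relations n m \<subseteq> ?K"
  proof
    fix p :: "(ssyt \<Rightarrow>\<^sub>0 nat) \<Rightarrow>\<^sub>0 'k" assume "p \<in> product_relations n m"
    then obtain T1 T2 T3 T4 where p: "p = pvar T1 * pvar T2 - pvar T3 * pvar T4"
      and T: "{T1, T2, T3, T4} \<subseteq> G_cols n m" "distinct [T1, T2, T3, T4]" "T1 + T2 = T3 + T4"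
      by (auto simp: product_relations_def)
    have TE: "{T1, T2, T3, T4} \<subseteq> ?Y" using T by (rule product_relation_in_E)
    have var: "pvar T \<in> (monomials.elements ?Y :: ((ssyt \<Rightarrow>\<^sub>0 nat) \<Rightarrow>\<^sub>0 'k) set)" if "T \<in> ?Y" for T
      unfolding pvar_def using that by (intro monomials.single_in_elements) auto
    have "\<phi> (Poly_Mapping.single (T + U) 1) = t T * t U" if "T \<in> ?Y" "U \<in> ?Y" for T U
    proof -
      have "T \<in> SSYT n m" "U \<in> SSYT n m" using that by (auto simp: E_cols_def G_cols_SSYT)
      from ring_hom_on_mult[OF SSYT.unital_subring_elements \<phi> this[THEN SSYT.single_in_elements], of 1 1]
      show ?thesis using that by (simp add: mult_single t_def)
    qed
    from this[of T1 T2] this[of T3 T4] have "t T1 * t T2 = t T3 * t T4" using TE T(3) by simp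
    then have "poly_value t p = 0" by (simp add: p poly_value_diff poly_value_mult poly_value_pvar)
    moreover have "p \<in> monomials.elements ?Y"
      unfolding p using TE by (intro subring_diff[OF S] subring_mult[OF S] var) auto
    ultimately show "p \<in> ?K" by simp
  qed
  ultimately have "P_ideal n m \<subseteq> ?K"
    unfolding P_ideal_def by (rule R.genideal_minimal)
  then show ?thesis by (auto simp: zero_locus_def simp flip: t_def) (auto simp: t_def)
qed

text \<open>
  The point is the linear extension of the product of values over columns. It exists for arbitrary
  values \<open>t'\<close> because no product relation mentions \<open>F_cols n m\<close>.
\<close>

lemma zero_locus_point:
  fixes t t' :: "ssyt \<Rightarrow> 'k::field"
  assumes t: "t \<in> zero_locus (E_cols n m) (P_ideal n m)"
  obtains \<phi> :: "(ssyt \<Rightarrow>\<^sub>0 'k) \<Rightarrow> 'k" where "ring_hom_on (SSYT.elements n m) \<phi>"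
    "\<forall>c. \<phi> (Poly_Mapping.single 0 c) = c"
    "\<forall>T \<in> E_cols n m. \<phi> (Poly_Mapping.single T 1) = t T"
    "\<forall>T \<in> F_cols n m. \<phi> (Poly_Mapping.single T 1) = t' T"
proof -
  define u where "u T = (if T \<in> E_cols n m then t T else t' T)" for T
  define \<phi> where "\<phi> = linear_extension (weight u)"
  have rel: "u a * u b = u c * u d"
    if T: "{a, b, c, d} \<subseteq> G_cols n m" "distinct [a, b, c, d]" "a + b = c + d" for a b c d
  proof -
    define p :: "(ssyt \<Rightarrow>\<^sub>0 nat) \<Rightarrow>\<^sub>0 'k" where "p = pvar a * pvar b - pvar c * pvar d"
    have "p \<in> product_relations n m" using T unfolding p_def product_relations_def by blast
    then have "p \<in> P_ideal n m" unfolding P_ideal_def genideal_def by blast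
    then have "poly_value t p = 0" using t by (simp add: zero_locus_def)
    then have "t a * t b = t c * t d" by (simp add: p_def poly_value_diff poly_value_mult poly_value_pvar)
    then show ?thesis using product_relation_in_E[OF T] by (simp add: u_def)
  qed
  have "ring_hom_on (SSYT.elements n m) \<phi>"
    unfolding \<phi>_def
    by (intro SSYT.linear_extension_hom weight_zero weight_plus product_relations_suffice[OF rel]) auto
  moreover have "\<phi> (Poly_Mapping.single 0 c) = c" for c
    by (simp add: \<phi>_def linear_extension_single weight_zero)
  moreover have "\<phi> (Poly_Mapping.single T 1) = u T" if "T \<in> G_cols n m" for T
    using weight_column[OF that, of u] by (simp add: \<phi>_def linear_extension_single)
  ultimately show ?thesis
    by (intro that[of \<phi>] ballI allI) (simp_all add: u_def G_cols_eq, simp add: E_cols_def)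
qed

theorem theorem3p2:
  fixes n m :: nat
  assumes "1 \<le> n" and "n \<le> m"
    and "card (F_cols n m) \<in> {2, 3}"
  shows "{M. maximalideal M
            (tableaux_algebra n m :: (ssyt \<Rightarrow>\<^sub>0 'k::{alg_closed_field, field_char_0}) ring)} =
         {M_ideal n m t t' | t t'.
            (t, t') \<in> zero_locus (E_cols n m) (P_ideal n m) \<times> (F_cols n m \<rightarrow>\<^sub>E UNIV)}"
proof (intro equalityI subsetI; clarsimp)
  fix M :: "(ssyt \<Rightarrow>\<^sub>0 'k) set" assume max: "maximalideal M (tableaux_algebra n m)"
  obtain \<phi> :: "(ssyt \<Rightarrow>\<^sub>0 'k) \<Rightarrow> 'k" where \<phi>: "ring_hom_on (SSYT.elements n m) \<phi>"
    and const: "\<forall>c. \<phi> (Poly_Mapping.single 0 c) = c" and M: "M = {f \<in> SSYT.elements n m. \<phi> f = 0}"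
    by (rule maximalideal_has_point[OF max])
  define x where "x T = \<phi> (Poly_Mapping.single T 1)" for T
  have "M = M_ideal n m (restrict x (E_cols n m)) (restrict x (F_cols n m))"
    unfolding M by (rule M_ideal_eq_kernel[OF \<phi>, symmetric]) (simp_all add: const x_def)
  moreover have "restrict x (E_cols n m) \<in> zero_locus (E_cols n m) (P_ideal n m)"
    unfolding x_def using \<phi> by (rule point_in_zero_locus)
  ultimately show "\<exists>t t'. M = M_ideal n m t t' \<and>
      t \<in> zero_locus (E_cols n m) (P_ideal n m) \<and> t' \<in> F_cols n m \<rightarrow>\<^sub>E UNIV"
    by (intro exI[of _ "restrict x (E_cols n m)"] exI[of _ "restrict x (F_cols n m)"] conjI) simp_all
next
  fix t t' :: "ssyt \<Rightarrow> 'k"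
  assume t: "t \<in> zero_locus (E_cols n m) (P_ideal n m)"
  obtain \<phi> :: "(ssyt \<Rightarrow>\<^sub>0 'k) \<Rightarrow> 'k" where \<phi>: "ring_hom_on (SSYT.elements n m) \<phi>"
    and const: "\<forall>c. \<phi> (Poly_Mapping.single 0 c) = c"
    and val: "\<forall>T \<in> E_cols n m. \<phi> (Poly_Mapping.single T 1) = t T"
      "\<forall>T \<in> F_cols n m. \<phi> (Poly_Mapping.single T 1) = t' T"
    by (rule zero_locus_point[OF t, of t'])
  have "M_ideal n m t t' = {f \<in> SSYT.elements n m. \<phi> f = 0}"
    by (rule M_ideal_eq_kernel[OF \<phi>]) (simp_all add: const val)
  then show "maximalideal (M_ideal n m t t') (tableaux_algebra n m)"
    using SSYT.kernel_maximal[OF \<phi>] const by (simp add: tableaux_algebra_def)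
qed

end
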